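(* Consider a multi-resolution times lattice Boltzmann scheme with data $v_j$, $M$, $\Phi$, $S$ as described in the context, with time step $\Delta t=\varepsilon\,\tau_0$ ($\tau_0>0$ fixed, $\varepsilon$ the small parameter), so that the moments $m=(W,Y)^{\rm t}$ and the post-relaxation moments $m^*=(W,Y^* )^{\rm t}$, $Y^*=Y+S\,(\Phi(W)-Y)$, satisfy $$ m(x,t+\varepsilon\tau_0)=\exp(-\varepsilon\,\tau_0\,\Lambda)\,m^*(x,t). $$ Assume the Chapman-Enskog hypotheses: (i) the particle distribution is expanded as $f=f^{\rm eq}+\varepsilon f^1+\varepsilon^2 f^2+\varepsilon^3 f^3+O(\varepsilon^4)$, where the conserved components of $M f^\ell$ vanish and the nonconserved components of $Mf^\ell$ depend only on $W$ and its spatial derivatives; equivalently $$ Y=\Phi(W)+S^{-1}\big(\varepsilon\,\tau_0\,\Psi_1(W)+\varepsilon^2\,\tau_0^2\,\Psi_2(W)+\varepsilon^3\,\tau_0^3\,\Psi_3(W)\big)+O(\varepsilon^4), $$ with $\Psi_1,\Psi_2,\Psi_3$ differential operators in space acting on $W$ (not depending on $\varepsilon$); (ii) the time derivative is expanded as $\partial_t=\partial_{t_1}+\varepsilon\,\partial_{t_2}+\varepsilon^2\,\partial_{t_3}+\varepsilon^3\,\partial_{t_4}+O(\varepsilon^4)$, where the operators $\partial_{t_1},\dots,\partial_{t_4}$ are not assumed to commute with one another. Then the conserved quantities $W$ follow the multiple time dynamics $$ \partial_{t_1}W+\Gamma_1(W)=0,\quad \partial_{t_2}W+\tau_0\,\Gamma_2(W)=0,\quad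 \partial_{t_3}W+\tau_0^2\,\Gamma_3(W)=0,\quad \partial_{t_4}W+\tau_0^3\,\Gamma_4(W)=0, $$ and the differential operators $\Gamma_1,\Psi_1,\Gamma_2,\Psi_2,\Gamma_3,\Psi_3,\Gamma_4$ are determined recursively as functions of the data $v_j,M,\Phi,S$ as follows, with $\Sigma=S^{-1}-\tfrac12\,\mathrm I$: First order: $$\Gamma_1=A\,W+B\,\Phi(W).$$ Second order: $$\Psi_1={\rm d}\Phi(W).\Gamma_1-(C\,W+D\,\Phi(W)),\qquad \Gamma_2=B\,\Sigma\,\Psi_1 .$$ Third order: $$\Psi_2=\Sigma\,{\rm d}\Psi_1.\Gamma_1+{\rm d}\Phi(W).\Gamma_2-D\,\Sigma\,\Psi_1,$$ $$\Gamma_3=B\,\Sigma\,\Psi_2-\tfrac16\,B\,{\rm d}\Psi_1.\Gamma_1+\tfrac1{12}\,B_2\,\Psi_1 .$$ Fourth order: $$\Psi_3=\Sigma\,{\rm d}\Psi_1.\Gamma_2+{\rm d}\Phi.\Gamma_3-D\,\Sigma\,\Psi_2+\Sigma\,{\rm d}\Psi_2.\Gamma_1+\tfrac16\,D\,{\rm d}\Psi_1.\Gamma_1-\tfrac1{12}\,D_2\,\Psi_1-\tfrac1{12}\,{\rm d}({\rm d}\Psi_1.\Gamma_1).\Gamma_1,$$ $$\Gamma_4=B\,\Sigma\,\Psi_3+\tfrac14\,B_2\,\Psi_2+\tfrac16\,B\,D_2\,\Sigma\,\Psi_1-\tfrac16\,A\,B\,\Psi_2-\tfrac16\,B\,{\rm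 d}({\rm d}\Phi.\Gamma_1).\Gamma_2-\tfrac16\,B\,{\rm d}({\rm d}\Phi.\Gamma_2).\Gamma_1-\tfrac16\,B\,\Sigma\,{\rm d}({\rm d}\Psi_1.\Gamma_1).\Gamma_1 .$$
   Context: **The scheme.** Let $d\ge1$ be the space dimension, $q$ the number of discrete velocities $v_0,\dots,v_{q-1}\in\mathbb R^d$ (the map $j\mapsto v_j$ need not be injective), and let $M$ be an invertible real $q\times q$ matrix. A particle distribution $f(x,t)=(f_j(x,t))_{0\le j<q}$ has moments $m=Mf$, split into blocks $m=(W,Y)^{\rm t}$, where $W$ (the first block) consists of the conserved moments and $Y$ of the nonconserved moments. A smooth function $\Phi$ gives the equilibrium $Y^{\rm eq}=\Phi(W)$, and $f^{\rm eq}=M^{-1}(W,\Phi(W))^{\rm t}$. The relaxation matrix $S$ is a constant invertible square matrix acting on the nonconserved block. One time step: relaxation $W^*=W$, $Y^*=Y+S(\Phi(W)-Y)$, $m^*=(W,Y^* )^{\rm t}$, $f^*=M^{-1}m^*$, followed by advection $f_j(x,t+\Delta t)=f_j^*(x-v_j\Delta t,t)$. **Standing assumptions.** $f$ is the restriction to the lattice of a very regular function of continuous $x\in\mathbb R^d$ and $t$. Acoustic scaling: $\Delta x/\Delta t$ is fixed as $\Delta t\to0$, so $v_j$, $M$, $\Phi$ are fixed; $S$ is also held fixed as $\varepsilon\to0$. **The operator $\Lambda$.** $\Lambda=M\,\mathrm{diag}_j\big(\sum_{\alpha=1}^d v_j^\alpha\,\partial_\alpha\big)\,M^{-1}$ is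 a $q\times q$ matrix whose entries are constant-coefficient first-order linear differential operators in space ($\partial_\alpha=\partial/\partial x_\alpha$). It is decomposed into blocks compatible with $m=(W,Y)^{\rm t}$: $$\Lambda=\begin{pmatrix}A&B\\C&D\end{pmatrix},\qquad \Lambda^2=\begin{pmatrix}A_2&B_2\\C_2&D_2\end{pmatrix},$$ so $A_2=A^2+BC$, $B_2=AB+BD$, $C_2=CA+DC$, $D_2=CB+D^2$. With Taylor expansion in space, the scheme in terms of moments reads $m(x,t+\Delta t)=\exp(-\Delta t\,\Lambda)\,m^*(x,t)$, where the exponential is the formal power series. **Conventions.** All expansions are formal power series in $\varepsilon$, identified order by order; $m(x,t+\varepsilon\tau_0)$ is expanded as $\exp(\varepsilon\tau_0\partial_t)\,m(x,t)$ with $\partial_t$ replaced by its multiscale expansion. Each $\Gamma_j(W)$ and $\Psi_j(W)$ is a (generally nonlinear) differential operator in space, a smooth function of $W$ and its spatial derivatives. For such an operator $F$, ${\rm d}F.G$ denotes the derivative of $F$ with respect to $W$ (taking into account the dependence on spatial derivatives of $W$) applied in the direction $G$: ${\rm d}F(W).G=\frac{{\rm d}}{{\rm d}s}F(W+sG)\big|_{s=0}$. For example ${\rm d}({\rm d}\Psi_1.\Gamma_1).\Gamma_1$ is the derivative, in the direction $\Gamma_1(W)$, of the operator $W\mapsto{\rm d}\Psi_1(W).\Gamma_1(W)$. Each $\partial_{t_k}$ is linear, commutes with constant matrices and with spatial derivatives, and acts by the chain rule $\partial_{t_k}F(W)={\rm d}F(W).\partial_{t_k}W$. *)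

theory Defs
  imports "HOL-Analysis.Analysis"
begin

primrec Ck :: "nat \<Rightarrow> ('a::euclidean_space \<Rightarrow> 'b::real_normed_vector) \<Rightarrow> bool" where
  "Ck 0 f \<longleftrightarrow> continuous_on UNIV f"
| "Ck (Suc k) f \<longleftrightarrow>
     f differentiable_on UNIV \<and> (\<forall>h. Ck k (\<lambda>x. frechet_derivative f (at x) h))"

definition smooth :: "('a::euclidean_space \<Rightarrow> 'b::real_normed_vector) \<Rightarrow> bool" where
  "smooth f \<longleftrightarrow> (\<forall>k. Ck k f)"

definition pd :: "'d::finite \<Rightarrow> (real^'d \<Rightarrow> 'b::real_normed_vector) \<Rightarrow> real^'d \<Rightarrow> 'b" where
  "pd \<alpha> u x = frechet_derivative u (at x) (axis \<alpha> 1)"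

text \<open>
  Jet coordinates are indexed by a list of space directions and a component of \<open>W\<close>:
  \<open>([\<alpha>, \<beta>, \<dots>], i)\<close> stands for \<open>\<partial>\<^sub>\<alpha> \<partial>\<^sub>\<beta> \<dots> W\<^sub>i\<close>. Lists that differ by a permutation give the
  same coordinate on smooth fields; this redundancy does not change which operators arise below.
\<close>

definition jet :: "(real^'d \<Rightarrow> real^'c) \<Rightarrow> real^'d \<Rightarrow> ('d::finite list \<times> 'c::finite) \<Rightarrow> real" where
  "jet W x = (\<lambda>(\<alpha>s, i). foldr pd \<alpha>s W x $ i)"

definition coord_deriv ::
    "'i \<Rightarrow> (('i \<Rightarrow> real) \<Rightarrow> 'b::real_normed_vector) \<Rightarrow> ('i \<Rightarrow> real) \<Rightarrow> 'b" where
  "coord_deriv i \<phi> u = vector_derivative (\<lambda>s. \<phi> (u(i := s))) (at (u i))"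

text \<open>
  Continuity refers to the product topology. For a function of finitely many coordinates this is
  ordinary continuity, so that \<open>jet_smooth\<close> is \<open>C\<^sup>\<infinity>\<close> in finitely many jet coordinates.
\<close>

primrec coord_Ck :: "nat \<Rightarrow> (('i \<Rightarrow> real) \<Rightarrow> 'b::real_normed_vector) \<Rightarrow> bool" where
  "coord_Ck 0 \<phi> \<longleftrightarrow> continuous_on UNIV \<phi>"
| "coord_Ck (Suc k) \<phi> \<longleftrightarrow>
     (\<forall>i. (\<forall>u. (\<lambda>s. \<phi> (u(i := s))) differentiable (at (u i))) \<and> coord_Ck k (coord_deriv i \<phi>))"

definition jet_smooth :: "(('i \<Rightarrow> real) \<Rightarrow> 'b::real_normed_vector) \<Rightarrow> bool" where
  "jet_smooth \<phi> \<longleftrightarrow>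
     (\<exists>J. finite J \<and> (\<forall>u u'. (\<forall>i\<in>J. u i = u' i) \<longrightarrow> \<phi> u = \<phi> u')) \<and> (\<forall>k. coord_Ck k \<phi>)"

text \<open>
  Operators are maps from fields to fields. Only their values on smooth fields matter.
\<close>

definition diff_op ::
    "((real^'d::finite \<Rightarrow> real^'c::finite) \<Rightarrow> real^'d \<Rightarrow> 'b::real_normed_vector) \<Rightarrow> bool" where
  "diff_op F \<longleftrightarrow> (\<exists>\<phi>. jet_smooth \<phi> \<and> (\<forall>W. smooth W \<longrightarrow> (\<forall>x. F W x = \<phi> (jet W x))))"

text \<open>\<open>dd F G\<close> is the operator \<open>dF.G\<close>, i.e. \<open>W \<mapsto> d/ds F(W + s G(W))\<close> at \<open>s = 0\<close>.\<close>

definition dd ::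
    "((real^'d \<Rightarrow> real^'c) \<Rightarrow> real^'d \<Rightarrow> 'b::real_normed_vector) \<Rightarrow>
     ((real^'d \<Rightarrow> real^'c) \<Rightarrow> real^'d \<Rightarrow> real^'c) \<Rightarrow>
     (real^'d::finite \<Rightarrow> real^'c::finite) \<Rightarrow> real^'d \<Rightarrow> 'b" where
  "dd F G W x = vector_derivative (\<lambda>s. F (\<lambda>y. W y + s *\<^sub>R G W y) x) (at 0)"

text \<open>
  The index type \<open>'c + 'y\<close> of the moments lists the conserved moments (\<open>Inl\<close>) and the
  nonconserved ones (\<open>Inr\<close>).
\<close>

definition mjoin :: "real^'c::finite \<Rightarrow> real^'y::finite \<Rightarrow> real^('c + 'y)" where
  "mjoin w y = (\<chi> i. case i of Inl a \<Rightarrow> w $ a | Inr b \<Rightarrow> y $ b)"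

definition cons :: "real^('c::finite + 'y::finite) \<Rightarrow> real^'c" where
  "cons m = (\<chi> a. m $ Inl a)"

definition noncons :: "real^('c::finite + 'y::finite) \<Rightarrow> real^'y" where
  "noncons m = (\<chi> b. m $ Inr b)"

definition block_cc where
  "block_cc L w x = cons (L (\<lambda>y. mjoin (w y) 0) x)"
definition block_cn where
  "block_cn L w x = cons (L (\<lambda>y. mjoin 0 (w y)) x)"
definition block_nc where
  "block_nc L w x = noncons (L (\<lambda>y. mjoin (w y) 0) x)"
definition block_nn where
  "block_nn L w x = noncons (L (\<lambda>y. mjoin 0 (w y)) x)"

text \<open>
  \<open>\<Lambda> = M diag\<^sub>j (\<Sum>\<^sub>\<alpha> v\<^sub>j\<^sup>\<alpha> \<partial>\<^sub>\<alpha>) M\<^sup>-\<^sup>1\<close>. The velocities are indexed by \<open>'q\<close>, and invertibility of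
  \<open>M\<close> makes the number of velocities equal to the number of moments.
\<close>

definition Lam ::
    "('q::finite \<Rightarrow> real^'d::finite) \<Rightarrow> real^'q^'m::finite \<Rightarrow>
     (real^'d \<Rightarrow> real^'m) \<Rightarrow> real^'d \<Rightarrow> real^'m" where
  "Lam v M u x =
     M *v (\<chi> j. \<Sum>\<alpha>\<in>UNIV. v j $ \<alpha> * pd \<alpha> (\<lambda>y. (matrix_inv M *v u y) $ j) x)"

text \<open>
  A formal power series in \<open>\<epsilon>\<close> with operator coefficients is the sequence of its coefficients.
\<close>

text \<open>Moments \<open>m = (W, Y)\<close> and \<open>m* = (W, Y + S (\<Phi>(W) - Y))\<close> for a series \<open>Y\<close>.\<close>

definition mom ::
    "(nat \<Rightarrow> (real^'d::finite \<Rightarrow> real^'c::finite) \<Rightarrow> real^'d \<Rightarrow> real^'y::finite) \<Rightarrow>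
     nat \<Rightarrow> (real^'d \<Rightarrow> real^'c) \<Rightarrow> real^'d \<Rightarrow> real^('c + 'y)" where
  "mom Y n W x = mjoin (if n = 0 then W x else 0) (Y n W x)"

definition relax ::
    "real^'y::finite^'y \<Rightarrow> (real^'c::finite \<Rightarrow> real^'y) \<Rightarrow>
     (nat \<Rightarrow> (real^'d::finite \<Rightarrow> real^'c) \<Rightarrow> real^'d \<Rightarrow> real^'y) \<Rightarrow>
     nat \<Rightarrow> (real^'d \<Rightarrow> real^'c) \<Rightarrow> real^'d \<Rightarrow> real^'y" where
  "relax S \<Phi> Y n W x = Y n W x + S *v ((if n = 0 then \<Phi> (W x) else 0) - Y n W x)"

text \<open>
  A time derivation acts on scalar operators, i.e. on the scalar functions of \<open>W\<close> and its spatial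
  derivatives, and on vector-valued ones componentwise. The operator \<open>\<lambda>W. W\<close> represents \<open>W\<close>
  itself, so \<open>tvec T (\<lambda>W. W)\<close> is \<open>\<partial>W\<close>, which is not assumed to be a differential operator.
\<close>

definition tvec ::
    "(((real^'d::finite \<Rightarrow> real^'c::finite) \<Rightarrow> real^'d \<Rightarrow> real) \<Rightarrow>
       (real^'d \<Rightarrow> real^'c) \<Rightarrow> real^'d \<Rightarrow> real) \<Rightarrow>
     ((real^'d \<Rightarrow> real^'c) \<Rightarrow> real^'d \<Rightarrow> real^'m::finite) \<Rightarrow>
     (real^'d \<Rightarrow> real^'c) \<Rightarrow> real^'d \<Rightarrow> real^'m" where
  "tvec T F W x = (\<chi> i. T (\<lambda>W' y. F W' y $ i) W x)"

text \<open>
  Linearity together with the componentwise action gives commutation with constant matrices.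
\<close>

definition time_derivation ::
    "(((real^'d::finite \<Rightarrow> real^'c::finite) \<Rightarrow> real^'d \<Rightarrow> real) \<Rightarrow>
       (real^'d \<Rightarrow> real^'c) \<Rightarrow> real^'d \<Rightarrow> real) \<Rightarrow> bool" where
  "time_derivation T \<longleftrightarrow>
     (\<forall>F G a b W x. diff_op F \<longrightarrow> diff_op G \<longrightarrow> smooth W \<longrightarrow>
        T (\<lambda>W' y. a * F W' y + b * G W' y) W x = a * T F W x + b * T G W x) \<and>
     (\<forall>F \<alpha> W x. diff_op F \<longrightarrow> smooth W \<longrightarrow>
        T (\<lambda>W'. pd \<alpha> (F W')) W x = pd \<alpha> (T F W) x) \<and>
     (\<forall>F W x. diff_op F \<longrightarrow> smooth W \<longrightarrow>
        T F W x = dd F (tvec T (\<lambda>W'. W')) W x)"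

text \<open>
  Exponential of an operator \<open>E\<close> on series that raises the order in \<open>\<epsilon>\<close> by at least one: powers
  \<open>E\<^sup>k\<close> with \<open>k > n\<close> do not contribute at order \<open>n\<close>.
\<close>

definition series_exp ::
    "((nat \<Rightarrow> 'f \<Rightarrow> 'x \<Rightarrow> 'b) \<Rightarrow> nat \<Rightarrow> 'f \<Rightarrow> 'x \<Rightarrow> 'b::real_vector) \<Rightarrow>
     (nat \<Rightarrow> 'f \<Rightarrow> 'x \<Rightarrow> 'b) \<Rightarrow> nat \<Rightarrow> 'f \<Rightarrow> 'x \<Rightarrow> 'b" where
  "series_exp E m n W x = (\<Sum>k\<le>n. (1 / fact k) *\<^sub>R (E ^^ k) m n W x)"

text \<open>
  \<open>\<epsilon> \<tau> \<partial>\<^sub>t\<close> with \<open>\<partial>\<^sub>t = \<Sum>\<^sub>k \<epsilon>\<^sup>k\<^sup>-\<^sup>1 \<partial>\<^bsub>t\<^sub>k\<^esub>\<close>, where \<open>T k\<close> is \<open>\<partial>\<^bsub>t\<^sub>k\<^esub>\<close> for \<open>k \<ge> 1\<close> and \<open>T 0\<close> is not used.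
  \<open>eps_adv\<close> is \<open>- \<epsilon> \<tau> L\<close>.
\<close>

definition eps_dt where
  "eps_dt \<tau> T m n W x = (\<Sum>k=1..n. \<tau> *\<^sub>R tvec (T k) (m (n - k)) W x)"

definition eps_adv where
  "eps_adv \<tau> L m n W x = (if n = 0 then 0 else - (\<tau> *\<^sub>R L (m (n - 1) W) x))"

locale lbm =
  fixes v :: "'q::finite \<Rightarrow> real^'d::finite"
    and M :: "real^'q^('c::finite + 'y::finite)"
    and \<Phi> :: "real^'c \<Rightarrow> real^'y"
    and S :: "real^'y^'y"
begin

definition "A = block_cc (Lam v M)"
definition "B = block_cn (Lam v M)"
definition "C = block_nc (Lam v M)"
definition "D = block_nn (Lam v M)"
definition "B2 = block_cn (Lam v M \<circ> Lam v M)"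
definition "D2 = block_nn (Lam v M \<circ> Lam v M)"

definition Phi :: "(real^'d \<Rightarrow> real^'c) \<Rightarrow> real^'d \<Rightarrow> real^'y" where
  "Phi W x = \<Phi> (W x)"

definition Sig :: "(real^'d \<Rightarrow> real^'y) \<Rightarrow> real^'d \<Rightarrow> real^'y" where
  "Sig u x = (matrix_inv S - (1/2) *\<^sub>R mat 1) *v u x"

definition \<Gamma>1 :: "(real^'d \<Rightarrow> real^'c) \<Rightarrow> real^'d \<Rightarrow> real^'c" where
  "\<Gamma>1 W x = A W x + B (Phi W) x"

definition \<Psi>1 :: "(real^'d \<Rightarrow> real^'c) \<Rightarrow> real^'d \<Rightarrow> real^'y" where
  "\<Psi>1 W x = dd Phi \<Gamma>1 W x - (C W x + D (Phi W) x)"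

definition \<Gamma>2 :: "(real^'d \<Rightarrow> real^'c) \<Rightarrow> real^'d \<Rightarrow> real^'c" where
  "\<Gamma>2 W x = B (Sig (\<Psi>1 W)) x"

definition \<Psi>2 :: "(real^'d \<Rightarrow> real^'c) \<Rightarrow> real^'d \<Rightarrow> real^'y" where
  "\<Psi>2 W x = Sig (dd \<Psi>1 \<Gamma>1 W) x + dd Phi \<Gamma>2 W x - D (Sig (\<Psi>1 W)) x"

definition \<Gamma>3 :: "(real^'d \<Rightarrow> real^'c) \<Rightarrow> real^'d \<Rightarrow> real^'c" where
  "\<Gamma>3 W x = B (Sig (\<Psi>2 W)) x - (1/6) *\<^sub>R B (dd \<Psi>1 \<Gamma>1 W) x + (1/12) *\<^sub>R B2 (\<Psi>1 W) x"

definition \<Psi>3 :: "(real^'d \<Rightarrow> real^'c) \<Rightarrow> real^'d \<Rightarrow> real^'y" where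
  "\<Psi>3 W x =
     Sig (dd \<Psi>1 \<Gamma>2 W) x + dd Phi \<Gamma>3 W x - D (Sig (\<Psi>2 W)) x + Sig (dd \<Psi>2 \<Gamma>1 W) x
     + (1/6) *\<^sub>R D (dd \<Psi>1 \<Gamma>1 W) x - (1/12) *\<^sub>R D2 (\<Psi>1 W) x
     - (1/12) *\<^sub>R dd (dd \<Psi>1 \<Gamma>1) \<Gamma>1 W x"

definition \<Gamma>4 :: "(real^'d \<Rightarrow> real^'c) \<Rightarrow> real^'d \<Rightarrow> real^'c" where
  "\<Gamma>4 W x =
     B (Sig (\<Psi>3 W)) x + (1/4) *\<^sub>R B2 (\<Psi>2 W) x + (1/6) *\<^sub>R B (D2 (Sig (\<Psi>1 W))) x
     - (1/6) *\<^sub>R A (B (\<Psi>2 W)) x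
     - (1/6) *\<^sub>R B (dd (dd Phi \<Gamma>1) \<Gamma>2 W) x - (1/6) *\<^sub>R B (dd (dd Phi \<Gamma>2) \<Gamma>1 W) x
     - (1/6) *\<^sub>R B (Sig (dd (dd \<Psi>1 \<Gamma>1) \<Gamma>1 W)) x"

end

end

theory Submission
  imports Defs
begin

text \<open>
  Both sides of the scheme are expanded in powers of \<open>\<epsilon>\<close>. By the chain rule
  \<open>\<partial>\<^bsub>t\<^sub>k\<^esub>\<close> is the derivation \<open>F \<mapsto> dF.(\<partial>\<^bsub>t\<^sub>k\<^esub>W)\<close>, so as soon as \<open>\<partial>\<^bsub>t\<^sub>k\<^esub>W = - \<tau>\<^bsup>k-1\<^esup> \<Gamma>\<^sub>k\<close> is known, it acts
  on all differential operators as \<open>F \<mapsto> - \<tau>\<^bsup>k-1\<^esup> dF.\<Gamma>\<^sub>k\<close> and inherits commutation with \<open>A, B, C, D\<close>.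
  The order \<open>n\<close> conserved equation contains \<open>\<partial>\<^bsub>t\<^sub>n\<^esub>\<close> only in \<open>\<partial>\<^bsub>t\<^sub>n\<^esub>W\<close> and gives \<open>\<Gamma>\<^sub>n\<close>; then the order \<open>n\<close>
  nonconserved equation contains \<open>\<Psi>\<^sub>n\<close> with coefficient \<open>S\<^sup>-\<^sup>1 - (S\<^sup>-\<^sup>1 - I) = I\<close> and gives \<open>\<Psi>\<^sub>n\<close>.
  Solving the formula for \<open>\<Psi>\<^sub>n\<close> for \<open>d\<Phi>.\<Gamma>\<^sub>n\<close> eliminates all derivatives of \<open>W\<close> and \<open>\<Phi>\<close>, after
  which each order is a linear identity between words in \<open>A, B, C, D, \<Sigma>\<close> and the derivatives of the
  \<open>\<Psi>\<^sub>k\<close>.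
\<close>

section \<open>Smooth functions and partial derivatives\<close>

lemma Ck_SucD: "Ck (Suc k) f \<Longrightarrow> Ck k f"
proof (induction k arbitrary: f)
  case 0
  then show ?case
    by (auto intro: differentiable_imp_continuous_on)
next
  case (Suc k)
  from Suc.prems have "f differentiable_on UNIV"
    and "\<And>h. Ck (Suc k) (\<lambda>x. frechet_derivative f (at x) h)"
    by auto
  with Suc.IH show ?case
    by simp
qed

lemma smooth_differentiable: "smooth f \<Longrightarrow> f differentiable (at x)"
proof -
  assume "smooth f"
  then have "Ck (Suc 0) f"
    unfolding smooth_def by blast
  then show ?thesis
    by (simp add: differentiable_on_def)
qed

lemma smooth_has_derivative:
  "smooth f \<Longrightarrow> (f has_derivative frechet_derivative f (at x)) (at x)"
  using smooth_differentiable frechet_derivative_works by blast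

lemma smooth_frechet_derivative: "smooth f \<Longrightarrow> smooth (\<lambda>x. frechet_derivative f (at x) h)"
proof -
  assume "smooth f"
  then have "Ck (Suc k) f" for k
    unfolding smooth_def by blast
  then show ?thesis
    by (simp add: smooth_def)
qed

text \<open>Any derivative family may be supplied, because derivatives are unique. The calculus
  rules below therefore never unfold \<open>frechet_derivative\<close>.\<close>

lemma Ck_SucI:
  assumes "\<And>x. (f has_derivative f' x) (at x)" "\<And>h. Ck k (\<lambda>x. f' x h)"
  shows "Ck (Suc k) f"
proof -
  have "frechet_derivative f (at x) = f' x" for x
    using assms(1) frechet_derivative_at by metis
  moreover have "f differentiable_on UNIV"
    unfolding differentiable_on_def differentiable_def using assms(1) by auto
  ultimately show ?thesis
    using assms(2) by simp
qed

lemma Ck_SucE: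
  assumes "Ck (Suc k) f"
  shows "(f has_derivative frechet_derivative f (at x)) (at x)"
    and "Ck k (\<lambda>x. frechet_derivative f (at x) h)"
  using assms by (simp_all add: differentiable_on_def frechet_derivative_works[symmetric])

lemma Ck_const: "Ck k (\<lambda>_. c)"
proof (induction k arbitrary: c)
  case (Suc k)
  show ?case
    by (rule Ck_SucI[where f' = "\<lambda>_ _. 0"]) (use Suc in \<open>auto\<close>)
qed simp

lemma Ck_add: "Ck k f \<Longrightarrow> Ck k g \<Longrightarrow> Ck k (\<lambda>x. f x + g x)"
proof (induction k arbitrary: f g)
  case 0
  then show ?case by (auto intro: continuous_intros)
next
  case (Suc k)
  note f = Ck_SucE[OF Suc.prems(1)]
  note g = Ck_SucE[OF Suc.prems(2)]
  show ?case
    by (rule Ck_SucI[OF has_derivative_add[OF f(1) g(1)]]) (intro Suc.IH f(2) g(2))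
qed

lemma Ck_scaleR: "Ck k f \<Longrightarrow> Ck k g \<Longrightarrow> Ck k (\<lambda>x. f x *\<^sub>R g x)"
proof (induction k arbitrary: f g)
  case 0
  then show ?case by (auto intro: continuous_intros)
next
  case (Suc k)
  note f = Ck_SucE[OF Suc.prems(1)]
  note g = Ck_SucE[OF Suc.prems(2)]
  \<comment> \<open>The product rule leaves undifferentiated factors, which are needed one level
    lower.\<close>
  have "Ck k f" "Ck k g"
    using Suc.prems Ck_SucD by blast+
  then show ?case
    by (intro Ck_SucI[OF has_derivative_scaleR[OF f(1) g(1)]] Ck_add Suc.IH f(2) g(2))
qed

lemma Ck_bounded_linear: "bounded_linear K \<Longrightarrow> Ck k f \<Longrightarrow> Ck k (\<lambda>x. K (f x))"
proof (induction k arbitrary: f)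
  case 0
  then show ?case by (auto intro: bounded_linear.continuous_on)
next
  case (Suc k)
  note f = Ck_SucE[OF Suc.prems(2)]
  show ?case
    by (intro Ck_SucI[OF bounded_linear.has_derivative[OF Suc.prems(1) f(1)]] Suc.IH Suc.prems(1) f(2))
qed

lemma Ck_sum: "(\<And>i. i \<in> I \<Longrightarrow> Ck k (f i)) \<Longrightarrow> Ck k (\<lambda>x. \<Sum>i\<in>I. f i x)"
  by (induction I rule: infinite_finite_induct) (auto intro: Ck_const Ck_add)

lemma smooth_const: "smooth (\<lambda>_. c)"
  by (simp add: smooth_def Ck_const)

lemma smooth_add: "smooth f \<Longrightarrow> smooth g \<Longrightarrow> smooth (\<lambda>x. f x + g x)"
  by (simp add: smooth_def Ck_add)

lemma smooth_bounded_linear: "bounded_linear K \<Longrightarrow> smooth f \<Longrightarrow> smooth (\<lambda>x. K (f x))"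
  by (simp add: smooth_def Ck_bounded_linear)

lemma smooth_scaleR: "smooth f \<Longrightarrow> smooth (\<lambda>x. a *\<^sub>R f x)"
  by (rule smooth_bounded_linear[OF bounded_linear_scaleR_right])

lemma smooth_sum: "(\<And>i. i \<in> I \<Longrightarrow> smooth (f i)) \<Longrightarrow> smooth (\<lambda>x. \<Sum>i\<in>I. f i x)"
  by (simp add: smooth_def Ck_sum)

lemma pd_eq: "(u has_derivative u') (at x) \<Longrightarrow> pd \<alpha> u x = u' (axis \<alpha> 1)"
  unfolding pd_def by (metis frechet_derivative_at)

lemma smooth_pd: "smooth u \<Longrightarrow> smooth (pd \<alpha> u)"
  using smooth_frechet_derivative[of u "axis \<alpha> 1"] by (simp add: pd_def[abs_def])

lemma pd_add: "smooth u \<Longrightarrow> smooth w \<Longrightarrow> pd \<alpha> (\<lambda>x. u x + w x) x = pd \<alpha> u x + pd \<alpha> w x"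
  by (subst pd_eq[OF has_derivative_add[OF smooth_has_derivative smooth_has_derivative]])
    (auto simp: pd_def)

lemma pd_bounded_linear:
  "bounded_linear K \<Longrightarrow> smooth u \<Longrightarrow> pd \<alpha> (\<lambda>x. K (u x)) x = K (pd \<alpha> u x)"
  by (subst pd_eq[OF bounded_linear.has_derivative[OF _ smooth_has_derivative]])
    (auto simp: pd_def)

lemma smooth_foldr_pd: "smooth u \<Longrightarrow> smooth (foldr pd \<alpha>s u)"
  by (induction \<alpha>s) (auto intro: smooth_pd)

text \<open>All spatial derivatives of \<open>W + s G\<close> are affine in \<open>s\<close>, so
  differentiating an operator along this line becomes a chain rule in the jet coordinates.\<close>

lemma foldr_pd_affine:
  assumes "smooth u" "smooth w"
  shows "foldr pd \<alpha>s (\<lambda>x. u x + s *\<^sub>R w x) = (\<lambda>x. foldr pd \<alpha>s u x + s *\<^sub>R foldr pd \<alpha>s w x)"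
proof (induction \<alpha>s)
  case (Cons \<alpha> \<alpha>s)
  have "pd \<alpha> (\<lambda>x. foldr pd \<alpha>s u x + s *\<^sub>R foldr pd \<alpha>s w x) x =
      pd \<alpha> (foldr pd \<alpha>s u) x + s *\<^sub>R pd \<alpha> (foldr pd \<alpha>s w) x" for x
    using assms
    by (simp add: pd_add pd_bounded_linear bounded_linear_scaleR_right smooth_foldr_pd smooth_scaleR)
  then show ?case
    using Cons by auto
qed simp

lemma jet_affine:
  fixes W G :: "real^'d::finite \<Rightarrow> real^'c::finite"
  assumes "smooth W" "smooth G"
  shows "jet (\<lambda>y. W y + s *\<^sub>R G y) x p = jet W x p + s * jet G x p"
  by (cases p) (simp add: jet_def foldr_pd_affine[OF assms])

lemma smooth_jet: "smooth W \<Longrightarrow> smooth (\<lambda>x. jet W x p)"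
  by (cases p) (simp add: jet_def smooth_bounded_linear[OF bounded_linear_vec_nth smooth_foldr_pd])

lemma pd_jet: "smooth W \<Longrightarrow> pd \<alpha> (\<lambda>x. jet W x p) x = jet W x (\<alpha> # fst p, snd p)"
  by (cases p) (simp add: jet_def pd_bounded_linear[OF bounded_linear_vec_nth smooth_foldr_pd])

section \<open>Smooth functions of finitely many jet coordinates\<close>

lemma continuous_on_fun_upd:
  fixes t :: real
  shows "continuous_on UNIV (\<lambda>u::'i \<Rightarrow> real. u(j := t))"
proof (rule continuous_on_coordinatewise_then_product)
  fix i
  show "continuous_on UNIV (\<lambda>u::'i \<Rightarrow> real. (u(j := t)) i)"
    by (cases "i = j") (auto intro: continuous_on_product_coordinates)
qed

text \<open>The function space carries the product topology, in which convergence is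
  coordinatewise.\<close>

lemma tendsto_coordinatewise:
  fixes l :: "'i \<Rightarrow> real"
  assumes "\<And>i. ((\<lambda>x. f x i) \<longlongrightarrow> l i) F"
  shows "(f \<longlongrightarrow> l) F"
  using assms limitin_componentwise[of "\<lambda>_::'i. euclidean :: real topology" UNIV f l F]
  by (simp add: euclidean_product_topology)

lemma coord_deriv_eq:
  "((\<lambda>s. \<phi> (u(i := s))) has_vector_derivative d) (at (u i)) \<Longrightarrow> coord_deriv i \<phi> u = d"
  unfolding coord_deriv_def by (rule vector_derivative_at)

text \<open>The chain rule through finitely many of possibly infinitely many coordinates. The space
  \<open>'i \<Rightarrow> real\<close> is not normed, so the derivative is stated for the composite
  with a map \<open>c\<close> from a normed space. Induction on \<open>J\<close> splits off one
  coordinate at a time, with continuity of its partial derivative as in the classical proof that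
  continuous partial derivatives give differentiability.\<close>

lemma has_derivative_coordinates:
  fixes \<phi> :: "('i \<Rightarrow> real) \<Rightarrow> 'b::real_normed_vector" and c :: "'a::real_normed_vector \<Rightarrow> 'i \<Rightarrow> real"
  assumes "finite J" "\<And>u u'. (\<forall>i\<in>J. u i = u' i) \<Longrightarrow> \<phi> u = \<phi> u'"
    and "\<And>i u. (\<lambda>s. \<phi> (u(i := s))) differentiable at (u i)"
    and "\<And>i. continuous_on UNIV (coord_deriv i \<phi>)"
    and c: "\<And>i. ((\<lambda>y. c y i) has_derivative c' i) (at x)"
  shows "((\<lambda>y. \<phi> (c y)) has_derivative (\<lambda>h. \<Sum>i\<in>J. c' i h *\<^sub>R coord_deriv i \<phi> (c x))) (at x)"
  using assms(1-4)
proof (induction J arbitrary: \<phi> rule: finite_induct)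
  case empty
  then have "(\<lambda>y. \<phi> (c y)) = (\<lambda>_. \<phi> (c x))"
    by auto
  then show ?case
    by simp
next
  case (insert j J)
  \<comment> \<open>Freezing coordinate \<open>j\<close> at its value at \<open>x\<close> leaves a
    function of the coordinates in \<open>J\<close> alone, which agrees with \<open>\<phi>\<close>
    at \<open>c x\<close>.\<close>
  define t where "t = c x j"
  define \<psi> where "\<psi> u = \<phi> (u(j := t))" for u
  have twist: "(u(i := s))(j := t) = (u(j := t))(i := s)" if "i \<noteq> j" for u :: "'i \<Rightarrow> real" and i s
    using that by (rule fun_upd_twist)
  have dpsi: "coord_deriv i \<psi> u = (if i = j then 0 else coord_deriv i \<phi> (u(j := t)))" for i u
    by (auto simp: coord_deriv_def \<psi>_def twist)
  have IH: "((\<lambda>y. \<psi> (c y)) has_derivative (\<lambda>h. \<Sum>i\<in>J. c' i h *\<^sub>R coord_deriv i \<psi> (c x))) (at x)"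
  proof (rule insert.IH)
    show "\<psi> u = \<psi> u'" if "\<forall>i\<in>J. u i = u' i" for u u'
      unfolding \<psi>_def by (rule insert.prems(1)) (use that in auto)
    show "(\<lambda>s. \<psi> (u(i := s))) differentiable at (u i)" for i u
    proof (cases "i = j")
      case False
      then have "(u(j := t)) i = u i"
        by simp
      then show ?thesis
        using insert.prems(2)[of "u(j := t)" i] unfolding \<psi>_def twist[OF False] by (simp only:)
    qed (simp add: \<psi>_def)
    show "continuous_on UNIV (coord_deriv i \<psi>)" for i
    proof (cases "i = j")
      case False
      have "continuous_on UNIV (\<lambda>u. coord_deriv i \<phi> (u(j := t)))"
        by (rule continuous_on_compose2[OF insert.prems(3) continuous_on_fun_upd]) auto
      with False show ?thesis
        by (simp add: dpsi[abs_def])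
    qed (simp add: dpsi[abs_def])
  qed
  have deriv_j: "((\<lambda>s. \<phi> (u(j := s))) has_vector_derivative coord_deriv j \<phi> (u(j := s))) (at s)" for u s
    using insert.prems(2)[of "u(j := s)" j]
    unfolding coord_deriv_def vector_derivative_works fun_upd_same fun_upd_upd .
  have cx: "(c x)(j := t) = c x"
    by (auto simp: t_def)
  \<comment> \<open>Joint continuity is needed only for the partial derivative in \<open>s\<close>,
    and only at the point \<open>(x, t)\<close>; the derivative in \<open>y\<close> is the one from
    the induction hypothesis.\<close>
  have upd_tendsto: "((\<lambda>(y, s). (c y)(j := s)) \<longlongrightarrow> (c x)(j := t)) (at (x, t))"
  proof (rule tendsto_coordinatewise)
    fix i
    have "isCont (\<lambda>y. c y i) x"
      using c has_derivative_continuous by blast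
    then have "((\<lambda>p. c (fst p) i) \<longlongrightarrow> c x i) (at (x, t))"
      by (intro isCont_tendsto_compose[where g = "\<lambda>y. c y i"]) (auto intro!: tendsto_eq_intros)
    then show "((\<lambda>p. (case p of (y, s) \<Rightarrow> (c y)(j := s)) i) \<longlongrightarrow> ((c x)(j := t)) i) (at (x, t))"
      by (cases "i = j") (auto simp: case_prod_unfold intro!: tendsto_eq_intros)
  qed
  have "((\<lambda>(y, s). \<phi> ((c y)(j := s))) has_derivative
      (\<lambda>(h, r). (\<Sum>i\<in>J. c' i h *\<^sub>R coord_deriv i \<psi> (c x)) +
        blinfun_scaleR_left (coord_deriv j \<phi> ((c x)(j := t))) r)) (at (x, t) within UNIV \<times> UNIV)"
  proof (rule has_derivative_partialsI[where fy = "\<lambda>y s. blinfun_scaleR_left (coord_deriv j \<phi> ((c y)(j := s)))"])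
    show "((\<lambda>y. \<phi> ((c y)(j := t))) has_derivative (\<lambda>h. \<Sum>i\<in>J. c' i h *\<^sub>R coord_deriv i \<psi> (c x))) (at x)"
      using IH by (simp add: \<psi>_def)
    show "((\<lambda>s. \<phi> ((c y)(j := s))) has_derivative
        blinfun_apply (blinfun_scaleR_left (coord_deriv j \<phi> ((c y)(j := s))))) (at s)" for y s
      using deriv_j by (simp add: has_vector_derivative_def)
    show "continuous (at (x, t) within UNIV \<times> UNIV)
        (\<lambda>(y, s). blinfun_scaleR_left (coord_deriv j \<phi> ((c y)(j := s))))"
      using upd_tendsto unfolding continuous_within case_prod_unfold
      by (auto intro!: bounded_linear.tendsto[OF bounded_linear_blinfun_scaleR_left]
          continuous_on_tendsto_compose[OF insert.prems(3)])
  qed auto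
  then have "((\<lambda>(y, s). \<phi> ((c y)(j := s))) has_derivative
      (\<lambda>(h, r). (\<Sum>i\<in>J. c' i h *\<^sub>R coord_deriv i \<psi> (c x)) + r *\<^sub>R coord_deriv j \<phi> (c x))) (at (x, c x j))"
    by (simp add: cx) (simp add: t_def)
  \<comment> \<open>Composing with \<open>y \<mapsto> (y, c y j)\<close> unfreezes coordinate
    \<open>j\<close>.\<close>
  then have "((\<lambda>y. (\<lambda>(y, s). \<phi> ((c y)(j := s))) (y, c y j)) has_derivative
      (\<lambda>h. (\<lambda>(h, r). (\<Sum>i\<in>J. c' i h *\<^sub>R coord_deriv i \<psi> (c x)) + r *\<^sub>R coord_deriv j \<phi> (c x))
        (h, c' j h))) (at x)"
    by (rule has_derivative_compose[rotated]) (auto intro!: derivative_eq_intros c)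
  moreover have "(\<Sum>i\<in>J. c' i h *\<^sub>R coord_deriv i \<psi> (c x)) =
      (\<Sum>i\<in>J. c' i h *\<^sub>R coord_deriv i \<phi> (c x))" for h
    using insert.hyps(2) by (intro sum.cong) (auto simp: dpsi cx)
  ultimately show ?case
    using insert.hyps by (simp add: add.commute)
qed

section \<open>Closure properties of smoothness in coordinates\<close>

definition coord_smooth :: "(('i \<Rightarrow> real) \<Rightarrow> 'b::real_normed_vector) \<Rightarrow> bool" where
  "coord_smooth \<phi> \<longleftrightarrow> (\<forall>k. coord_Ck k \<phi>)"

lemma coord_smooth_continuous: "coord_smooth \<phi> \<Longrightarrow> continuous_on UNIV \<phi>"
  unfolding coord_smooth_def by (metis coord_Ck.simps(1))

lemma coord_smooth_has_vector_derivative: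
  assumes "coord_smooth \<phi>"
  shows "((\<lambda>s. \<phi> (u(i := s))) has_vector_derivative coord_deriv i \<phi> u) (at (u i))"
proof -
  have "coord_Ck (Suc 0) \<phi>"
    using assms unfolding coord_smooth_def by blast
  then show ?thesis
    by (simp add: coord_deriv_def vector_derivative_works)
qed

lemma coord_smooth_coord_deriv: "coord_smooth \<phi> \<Longrightarrow> coord_smooth (coord_deriv i \<phi>)"
  unfolding coord_smooth_def by (metis coord_Ck.simps(2))

lemma coord_Ck_SucI:
  assumes "\<And>i u. ((\<lambda>s. \<phi> (u(i := s))) has_vector_derivative \<phi>' i u) (at (u i))"
    and "\<And>i. coord_Ck k (\<phi>' i)"
  shows "coord_Ck (Suc k) \<phi>"
proof -
  have "coord_deriv i \<phi> = \<phi>' i" for i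
    by (rule ext) (rule coord_deriv_eq[OF assms(1)])
  then show ?thesis
    unfolding coord_Ck.simps using assms(2) differentiableI_vector[OF assms(1)] by auto
qed

lemma coord_Ck_SucE:
  assumes "coord_Ck (Suc k) \<phi>"
  shows "((\<lambda>s. \<phi> (u(i := s))) has_vector_derivative coord_deriv i \<phi> u) (at (u i))"
    and "coord_Ck k (coord_deriv i \<phi>)"
  using assms unfolding coord_Ck.simps coord_deriv_def vector_derivative_works[symmetric] by blast+

lemma coord_smooth_const: "coord_smooth (\<lambda>_ :: 'i \<Rightarrow> real. c :: 'b::real_normed_vector)"
proof -
  have "coord_Ck k (\<lambda>_::'i \<Rightarrow> real. c)" for k and c :: 'b
  proof (induction k arbitrary: c)
    case (Suc k)
    show ?case
      by (rule coord_Ck_SucI[where \<phi>' = "\<lambda>_ _. 0"]) (use Suc in auto)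
  qed simp
  then show ?thesis
    by (simp add: coord_smooth_def)
qed

lemma coord_smooth_coord: "coord_smooth (\<lambda>u :: 'i \<Rightarrow> real. u j)"
proof -
  have "coord_Ck k (\<lambda>u::'i \<Rightarrow> real. u j)" for k
  proof (cases k)
    case (Suc k)
    have "coord_Ck (Suc k) (\<lambda>u::'i \<Rightarrow> real. u j)"
      by (rule coord_Ck_SucI[where \<phi>' = "\<lambda>i _. if i = j then 1 else 0"])
        (use coord_smooth_const in \<open>auto simp: coord_smooth_def intro!: derivative_eq_intros\<close>)
    then show ?thesis
      using Suc by simp
  qed (simp add: continuous_on_product_coordinates)
  then show ?thesis
    by (simp add: coord_smooth_def)
qed

lemma coord_Ck_add: "coord_Ck k f \<Longrightarrow> coord_Ck k g \<Longrightarrow> coord_Ck k (\<lambda>u. f u + g u)"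
proof (induction k arbitrary: f g)
  case 0
  then show ?case by (auto intro: continuous_intros)
next
  case (Suc k)
  show ?case
    by (rule coord_Ck_SucI[OF has_vector_derivative_add[OF
            coord_Ck_SucE(1)[OF Suc.prems(1)] coord_Ck_SucE(1)[OF Suc.prems(2)]]])
      (intro Suc.IH coord_Ck_SucE(2) Suc.prems)
qed

lemma coord_smooth_add: "coord_smooth f \<Longrightarrow> coord_smooth g \<Longrightarrow> coord_smooth (\<lambda>u. f u + g u)"
  by (simp add: coord_smooth_def coord_Ck_add)

text \<open>In contrast to sums, the induction keeps factors that are smooth of every order: the
  product rule leaves undifferentiated factors, and without finite dependence
  \<open>coord_Ck (Suc k)\<close> does not yield \<open>coord_Ck k\<close>.\<close>

lemma coord_smooth_scaleR:
  assumes "coord_smooth f" "coord_smooth g"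
  shows "coord_smooth (\<lambda>u. f u *\<^sub>R g u)"
proof -
  have "coord_Ck k (\<lambda>u. f u *\<^sub>R g u)" for k
    using assms
  proof (induction k arbitrary: f g)
    case 0
    then show ?case by (auto intro: continuous_intros dest!: coord_smooth_continuous)
  next
    case (Suc k)
    have "((\<lambda>s. f (u(i := s)) *\<^sub>R g (u(i := s))) has_vector_derivative
        f u *\<^sub>R coord_deriv i g u + coord_deriv i f u *\<^sub>R g u) (at (u i))" for i u
      using bounded_bilinear.has_vector_derivative[OF bounded_bilinear_scaleR
          coord_smooth_has_vector_derivative[OF Suc.prems(1), of u i]
          coord_smooth_has_vector_derivative[OF Suc.prems(2), of u i]]
      by (simp only: fun_upd_triv)
    then show ?case
      by (rule coord_Ck_SucI) (intro coord_Ck_add Suc.IH coord_smooth_coord_deriv Suc.prems)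
  qed
  then show ?thesis
    by (simp add: coord_smooth_def)
qed

lemma coord_smooth_bounded_linear:
  assumes "bounded_linear K" "coord_smooth f"
  shows "coord_smooth (\<lambda>u. K (f u))"
proof -
  have "coord_Ck k (\<lambda>u. K (f u))" for k
    using assms(2)
  proof (induction k arbitrary: f)
    case 0
    then show ?case
      using assms(1) by (auto intro: bounded_linear.continuous_on dest!: coord_smooth_continuous)
  next
    case (Suc k)
    have "((\<lambda>s. K (f (u(i := s)))) has_vector_derivative K (coord_deriv i f u)) (at (u i))" for i u
      by (intro bounded_linear.has_vector_derivative[OF assms(1)]
          coord_smooth_has_vector_derivative Suc.prems)
    then show ?case
      by (rule coord_Ck_SucI) (intro Suc.IH coord_smooth_coord_deriv Suc.prems)
  qed
  then show ?thesis
    by (simp add: coord_smooth_def)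
qed

text \<open>The derivative in coordinate \<open>q\<close> is the derivative of \<open>\<Phi>\<close>
  in the constant direction that marks the components selected from \<open>q\<close>. It is again a
  smooth function of the same selected coordinates, so the induction over \<open>\<Phi>\<close>
  closes.\<close>

lemma coord_smooth_smooth_comp:
  fixes \<Phi> :: "real^'c::finite \<Rightarrow> 'b::real_normed_vector" and p :: "'c \<Rightarrow> 'i"
  assumes "smooth \<Phi>"
  shows "coord_smooth (\<lambda>u. \<Phi> (\<chi> i. u (p i)))"
proof -
  have "coord_Ck k (\<lambda>u. \<Phi> (\<chi> i. u (p i)))" for k
    using assms
  proof (induction k arbitrary: \<Phi>)
    case 0
    then have "continuous_on UNIV \<Phi>"
      unfolding smooth_def by (metis Ck.simps(1))
    then show ?case
      by (auto intro!: continuous_on_compose2[of UNIV \<Phi>] continuous_on_vec_lambda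
          continuous_on_product_coordinates)
  next
    case (Suc k)
    have "((\<lambda>s. \<Phi> (\<chi> i. (u(q := s)) (p i))) has_vector_derivative
        frechet_derivative \<Phi> (at (\<chi> i. u (p i))) (\<chi> i. if p i = q then 1 else 0)) (at (u q))"
      for q and u :: "'i \<Rightarrow> real"
    proof -
      have "((\<lambda>s. \<chi> i. (u(q := s)) (p i)) has_vector_derivative (\<chi> i. if p i = q then 1 else 0)) (at (u q))"
        unfolding has_vector_derivative_def
      proof (rule has_derivative_componentwise_within[THEN iffD2, rule_format])
        fix b :: "real^'c"
        assume "b \<in> Basis"
        then obtain j where b: "b = axis j 1"
          by (auto simp: Basis_vec_def)
        have "((\<lambda>s. (u(q := s)) (p j)) has_derivative (\<lambda>r. r * (if p j = q then 1 else 0))) (at (u q))"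
          by (cases "p j = q") (auto intro!: derivative_eq_intros)
        then show "((\<lambda>s. (\<chi> i. (u(q := s)) (p i)) \<bullet> b) has_derivative
            (\<lambda>r. r *\<^sub>R (\<chi> i. if p i = q then 1 else 0) \<bullet> b)) (at (u q))"
          unfolding b by (simp only: inner_axis inner_real_def inner_scaleR_left vec_lambda_beta) simp
      qed
      moreover have "(\<Phi> has_derivative frechet_derivative \<Phi> (at (\<chi> i. (u(q := u q)) (p i))))
          (at (\<chi> i. (u(q := u q)) (p i)))"
        by (rule smooth_has_derivative[OF Suc.prems])
      ultimately have "((\<Phi> \<circ> (\<lambda>s. \<chi> i. (u(q := s)) (p i))) has_vector_derivative
          frechet_derivative \<Phi> (at (\<chi> i. (u(q := u q)) (p i))) (\<chi> i. if p i = q then 1 else 0)) (at (u q))"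
        by (rule vector_derivative_diff_chain_within[OF _ has_derivative_at_withinI])
      then show ?thesis
        by (simp only: fun_upd_triv o_def)
    qed
    then show ?case
      by (rule coord_Ck_SucI) (intro Suc.IH smooth_frechet_derivative Suc.prems)
  qed
  then show ?thesis
    by (simp add: coord_smooth_def)
qed

definition depends_on :: "'i set \<Rightarrow> (('i \<Rightarrow> real) \<Rightarrow> 'b) \<Rightarrow> bool" where
  "depends_on J \<phi> \<longleftrightarrow> (\<forall>u u'. (\<forall>i\<in>J. u i = u' i) \<longrightarrow> \<phi> u = \<phi> u')"

lemma depends_onD: "depends_on J \<phi> \<Longrightarrow> (\<And>i. i \<in> J \<Longrightarrow> u i = u' i) \<Longrightarrow> \<phi> u = \<phi> u'"
  unfolding depends_on_def by blast

lemma jet_smooth_iff: "jet_smooth \<phi> \<longleftrightarrow> (\<exists>J. finite J \<and> depends_on J \<phi>) \<and> coord_smooth \<phi>"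
  unfolding jet_smooth_def coord_smooth_def depends_on_def by blast

lemma jet_smooth_const: "jet_smooth (\<lambda>_. c)"
  unfolding jet_smooth_iff depends_on_def using coord_smooth_const by blast

lemma jet_smooth_coord: "jet_smooth (\<lambda>u :: 'i \<Rightarrow> real. u i)"
proof -
  have "finite {i}" "depends_on {i} (\<lambda>u :: 'i \<Rightarrow> real. u i)"
    by (simp_all add: depends_on_def)
  then show ?thesis
    unfolding jet_smooth_iff using coord_smooth_coord[of i] by (intro conjI exI)
qed

lemma jet_smooth_imp_coord_smooth: "jet_smooth f \<Longrightarrow> coord_smooth f"
  by (simp add: jet_smooth_iff)

text \<open>Finite dependence passes to the union of the two index sets; smoothness is left as a
  premise, since it depends on the operation \<open>h\<close>.\<close>

lemma jet_smooth_combine: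
  assumes "jet_smooth f" "jet_smooth g" "coord_smooth (\<lambda>u. h (f u) (g u))"
  shows "jet_smooth (\<lambda>u. h (f u) (g u))"
proof -
  obtain J J' where J: "finite J" "depends_on J f" "finite J'" "depends_on J' g"
    using assms(1,2) unfolding jet_smooth_iff by blast
  have "depends_on (J \<union> J') (\<lambda>u. h (f u) (g u))"
    unfolding depends_on_def
  proof (intro allI impI)
    fix u u' :: "'a \<Rightarrow> real"
    assume "\<forall>i\<in>J \<union> J'. u i = u' i"
    then have "f u = f u'" "g u = g u'"
      by (auto intro: depends_onD[OF J(2)] depends_onD[OF J(4)])
    then show "h (f u) (g u) = h (f u') (g u')"
      by simp
  qed
  then show ?thesis
    unfolding jet_smooth_iff using J assms(3) by (intro conjI exI) auto
qed

lemma jet_smooth_add: "jet_smooth f \<Longrightarrow> jet_smooth g \<Longrightarrow> jet_smooth (\<lambda>u. f u + g u)"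
  by (rule jet_smooth_combine[where h = "(+)"])
    (simp_all add: coord_smooth_add jet_smooth_imp_coord_smooth)

lemma jet_smooth_scaleR: "jet_smooth f \<Longrightarrow> jet_smooth g \<Longrightarrow> jet_smooth (\<lambda>u. f u *\<^sub>R g u)"
  by (rule jet_smooth_combine[where h = "(*\<^sub>R)"])
    (simp_all add: coord_smooth_scaleR jet_smooth_imp_coord_smooth)

lemma jet_smooth_bounded_linear:
  "bounded_linear K \<Longrightarrow> jet_smooth f \<Longrightarrow> jet_smooth (\<lambda>u. K (f u))"
  by (rule jet_smooth_combine[where h = "\<lambda>a _. K a"])
    (simp_all add: coord_smooth_bounded_linear jet_smooth_imp_coord_smooth)

lemma depends_on_coord_deriv: "depends_on J \<phi> \<Longrightarrow> depends_on J (coord_deriv i \<phi>)"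
  unfolding depends_on_def
proof (intro allI impI)
  fix u u' :: "'a \<Rightarrow> real"
  assume dep: "\<forall>u u'. (\<forall>i\<in>J. u i = u' i) \<longrightarrow> \<phi> u = \<phi> u'" and eq: "\<forall>i\<in>J. u i = u' i"
  have upd: "\<phi> (u(i := s)) = \<phi> (u'(i := s))" for s
    by (rule dep[rule_format]) (use eq in auto)
  show "coord_deriv i \<phi> u = coord_deriv i \<phi> u'"
  proof (cases "i \<in> J")
    case True
    then show ?thesis
      using eq upd by (simp add: coord_deriv_def)
  next
    case False
    \<comment> \<open>Here the base points \<open>u i\<close> and \<open>u' i\<close> may differ,
      but both restrictions are constant, so both derivatives vanish.\<close>
    have "\<phi> (u(i := s)) = \<phi> u" "\<phi> (u'(i := s)) = \<phi> u'" for s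
      by (rule dep[rule_format]; use False in auto)+
    then show ?thesis
      by (simp add: coord_deriv_def)
  qed
qed

lemma jet_smooth_coord_deriv: "jet_smooth \<phi> \<Longrightarrow> jet_smooth (coord_deriv i \<phi>)"
  unfolding jet_smooth_iff
  by (elim conjE exE) (intro conjI exI, assumption, rule depends_on_coord_deriv, assumption,
      rule coord_smooth_coord_deriv, assumption)

lemma jet_smooth_smooth_comp:
  fixes \<Phi> :: "real^'c::finite \<Rightarrow> 'b::real_normed_vector" and p :: "'c \<Rightarrow> 'i"
  assumes "smooth \<Phi>"
  shows "jet_smooth (\<lambda>u. \<Phi> (\<chi> i. u (p i)))"
proof -
  have "depends_on (range p) (\<lambda>u. \<Phi> (\<chi> i. u (p i)))"
    unfolding depends_on_def by (auto intro!: arg_cong[where f = \<Phi>] simp: vec_eq_iff)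
  then show ?thesis
    unfolding jet_smooth_iff
    using coord_smooth_smooth_comp[OF assms, of p] finite_imageI[OF finite, of p UNIV]
    by (intro conjI exI)
qed

lemma coord_smooth_has_derivative:
  assumes "coord_smooth \<phi>" "finite J" "depends_on J \<phi>"
    and "\<And>i. ((\<lambda>y. c y i) has_derivative c' i) (at x)"
  shows "((\<lambda>y. \<phi> (c y)) has_derivative (\<lambda>h. \<Sum>i\<in>J. c' i h *\<^sub>R coord_deriv i \<phi> (c x))) (at x)"
proof (rule has_derivative_coordinates[OF assms(2) _ _ _ assms(4)])
  show "\<phi> u = \<phi> u'" if "\<forall>i\<in>J. u i = u' i" for u u'
    using assms(3) that unfolding depends_on_def by blast
  show "(\<lambda>s. \<phi> (u(i := s))) differentiable at (u i)" for i u
    using coord_smooth_has_vector_derivative[OF assms(1)] differentiableI_vector by blast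
  show "continuous_on UNIV (coord_deriv i \<phi>)" for i
    by (intro coord_smooth_continuous coord_smooth_coord_deriv assms(1))
qed

section \<open>Closure properties of differential operators\<close>

text \<open>By the chain rule the derivative is a finite sum of smooth functions times
  \<open>coord_deriv i \<phi>\<close> along the jet. The latter has the same form, which drives the
  induction on \<open>k\<close> for all \<open>\<phi>\<close> at once.\<close>

lemma smooth_jet_comp:
  fixes \<phi> :: "('d::finite list \<times> 'c::finite \<Rightarrow> real) \<Rightarrow> 'b::real_normed_vector"
  assumes "jet_smooth \<phi>" "smooth W"
  shows "smooth (\<lambda>x. \<phi> (jet W x))"
proof -
  have "Ck k (\<lambda>x. \<phi> (jet W x))" for k
    using assms(1)
  proof (induction k arbitrary: \<phi>)
    case 0
    then obtain J where J: "finite J" "depends_on J \<phi>" "coord_smooth \<phi>"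
      unfolding jet_smooth_iff by blast
    have "((\<lambda>x. \<phi> (jet W x)) has_derivative
        (\<lambda>h. \<Sum>i\<in>J. frechet_derivative (\<lambda>x. jet W x i) (at x) h *\<^sub>R coord_deriv i \<phi> (jet W x))) (at x)" for x
      by (rule coord_smooth_has_derivative[OF J(3,1,2) smooth_has_derivative[OF smooth_jet[OF assms(2)]]])
    then show ?case
      unfolding Ck.simps by (intro continuous_at_imp_continuous_on ballI) (rule has_derivative_continuous)
  next
    case (Suc k)
    then obtain J where J: "finite J" "depends_on J \<phi>" "coord_smooth \<phi>"
      unfolding jet_smooth_iff by blast
    have "Ck k (\<lambda>x. frechet_derivative (\<lambda>x. jet W x i) (at x) h)" for h i
      using smooth_frechet_derivative[OF smooth_jet[OF assms(2)]] by (simp add: smooth_def)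
    then show ?case
      by (intro Ck_SucI[OF coord_smooth_has_derivative[OF J(3,1,2)
              smooth_has_derivative[OF smooth_jet[OF assms(2)]]]] Ck_sum Ck_scaleR
          Suc.IH jet_smooth_coord_deriv Suc.prems)
  qed
  then show ?thesis
    by (simp add: smooth_def)
qed

lemma diff_opI:
  assumes "jet_smooth \<phi>" "\<And>W x. smooth W \<Longrightarrow> F W x = \<phi> (jet W x)"
  shows "diff_op F"
  using assms unfolding diff_op_def by blast

lemma diff_op_cong:
  assumes "\<And>W x. smooth W \<Longrightarrow> F W x = G W x"
  shows "diff_op F \<longleftrightarrow> diff_op G"
  using assms by (simp add: diff_op_def)

lemma diff_opE:
  assumes "diff_op F"
  obtains \<phi> J where "jet_smooth \<phi>" "coord_smooth \<phi>" "finite J" "depends_on J \<phi>"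
    "\<forall>W. smooth W \<longrightarrow> F W = (\<lambda>x. \<phi> (jet W x))"
proof -
  obtain \<phi> where \<phi>: "jet_smooth \<phi>" "\<forall>W. smooth W \<longrightarrow> (\<forall>x. F W x = \<phi> (jet W x))"
    using assms unfolding diff_op_def by blast
  then obtain J where "finite J" "depends_on J \<phi>" "coord_smooth \<phi>"
    unfolding jet_smooth_iff by blast
  then show ?thesis
    using \<phi> by (intro that[of \<phi> J]) auto
qed

lemma smooth_diff_op: "diff_op F \<Longrightarrow> smooth W \<Longrightarrow> smooth (F W)"
  by (erule diff_opE) (simp add: smooth_jet_comp)

lemma diff_op_const: "diff_op (\<lambda>_ _. c)"
  by (rule diff_opI[OF jet_smooth_const]) simp

lemma diff_op_add: "diff_op F \<Longrightarrow> diff_op G \<Longrightarrow> diff_op (\<lambda>W x. F W x + G W x)"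
  by (elim diff_opE) (rule diff_opI[OF jet_smooth_add], simp_all)

lemma diff_op_scaleR: "diff_op f \<Longrightarrow> diff_op G \<Longrightarrow> diff_op (\<lambda>W x. f W x *\<^sub>R G W x)"
  by (elim diff_opE) (rule diff_opI[OF jet_smooth_scaleR], simp_all)

lemma diff_op_bounded_linear: "bounded_linear K \<Longrightarrow> diff_op F \<Longrightarrow> diff_op (\<lambda>W x. K (F W x))"
  by (elim diff_opE) (rule diff_opI[OF jet_smooth_bounded_linear], assumption+, simp)

lemma diff_op_diff:
  assumes "diff_op F" "diff_op G"
  shows "diff_op (\<lambda>W x. F W x - G W x)"
  using diff_op_add[OF assms(1) diff_op_bounded_linear[OF bounded_linear_minus[OF bounded_linear_ident] assms(2)]]
  by simp

lemma diff_op_sum: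
  "(\<And>i. i \<in> I \<Longrightarrow> diff_op (F i)) \<Longrightarrow> diff_op (\<lambda>W x. \<Sum>i\<in>I. F i W x)"
  by (induction I rule: infinite_finite_induct) (auto intro: diff_op_const diff_op_add)

lemma diff_op_jet: "diff_op (\<lambda>W x. jet W x p)"
  by (rule diff_opI[OF jet_smooth_coord]) simp

lemma diff_op_coord_deriv_jet: "jet_smooth \<phi> \<Longrightarrow> diff_op (\<lambda>W x. coord_deriv i \<phi> (jet W x))"
  by (rule diff_opI[OF jet_smooth_coord_deriv]) simp_all

lemma diff_op_smooth_comp:
  assumes "smooth \<Phi>"
  shows "diff_op (\<lambda>W x. \<Phi> (W x))"
  by (rule diff_opI[OF jet_smooth_smooth_comp[OF assms, where p = "\<lambda>i. ([], i)"]]) (simp add: jet_def)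

lemma diff_op_id: "diff_op (\<lambda>W :: real^'d::finite \<Rightarrow> real^'c::finite. W)"
proof -
  have "Ck k (\<lambda>w::real^'c. w)" for k
  proof (cases k)
    case (Suc n)
    show ?thesis
      unfolding Suc by (rule Ck_SucI[OF has_derivative_ident]) (rule Ck_const)
  qed simp
  then have "smooth (\<lambda>w::real^'c. w)"
    by (simp add: smooth_def)
  from diff_op_smooth_comp[OF this] show ?thesis .
qed

text \<open>This is the total derivative: differentiating in space prepends the direction \<alpha>
  to the index of each jet coordinate on which the operator depends.\<close>

lemma diff_op_pd:
  assumes "diff_op F"
  shows "diff_op (\<lambda>W. pd \<alpha> (F W))"
proof -
  obtain \<phi> J where \<phi>: "jet_smooth \<phi>" "coord_smooth \<phi>" "finite J" "depends_on J \<phi>"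
    "\<forall>W. smooth W \<longrightarrow> F W = (\<lambda>x. \<phi> (jet W x))"
    using assms by (rule diff_opE)
  have "pd \<alpha> (F W) x = (\<Sum>i\<in>J. jet W x (\<alpha> # fst i, snd i) *\<^sub>R coord_deriv i \<phi> (jet W x))"
    if "smooth W" for W x
    unfolding \<phi>(5)[rule_format, OF that]
    by (subst pd_eq[OF coord_smooth_has_derivative[OF \<phi>(2-4)
              smooth_has_derivative[OF smooth_jet[OF that]]]])
      (simp add: pd_def[symmetric] pd_jet[OF that])
  then show ?thesis
    by (subst diff_op_cong)
      (assumption, intro diff_op_sum diff_op_scaleR diff_op_jet diff_op_coord_deriv_jet \<phi>(1))
qed

lemma diff_op_jet_comp:
  assumes "diff_op G"
  shows "diff_op (\<lambda>W x. jet (G W) x p)"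
proof -
  have "diff_op (\<lambda>W. foldr pd \<alpha>s (G W))" for \<alpha>s
    by (induction \<alpha>s) (auto intro: diff_op_pd assms)
  then show ?thesis
    by (cases p) (simp add: jet_def diff_op_bounded_linear[OF bounded_linear_vec_nth])
qed

section \<open>The derivative dF.G in jet coordinates\<close>

lemma has_vector_derivative_jet_comp:
  assumes "coord_smooth \<phi>" "finite J" "depends_on J \<phi>" "smooth W" "smooth V"
  shows "((\<lambda>s. \<phi> (jet (\<lambda>y. W y + s *\<^sub>R V y) x)) has_vector_derivative
    (\<Sum>i\<in>J. jet V x i *\<^sub>R coord_deriv i \<phi> (jet W x))) (at 0)"
proof -
  \<comment> \<open>Each jet coordinate is affine in \<open>s\<close> with slope the jet of
    \<open>V\<close>. The chain rule then expresses dF.G by the jet of the direction and the partial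
    derivatives of F.\<close>
  have *: "((\<lambda>s. jet (\<lambda>y. W y + s *\<^sub>R V y) x i) has_derivative (\<lambda>h. h * jet V x i)) (at 0)" for i
    unfolding jet_affine[OF assms(4,5)] by (auto intro!: derivative_eq_intros)
  show ?thesis
    using coord_smooth_has_derivative[OF assms(1-3) *]
    by (simp add: has_vector_derivative_def scaleR_sum_right)
qed

lemma smooth_affine: "smooth W \<Longrightarrow> smooth V \<Longrightarrow> smooth (\<lambda>y. W y + s *\<^sub>R V y)"
  by (intro smooth_add smooth_scaleR)

text \<open>Shows that the derivative chosen by \<open>dd\<close> exists. The direction enters only
  through the single smooth field \<open>G W\<close>.\<close>

lemma dd_has_vector_derivative:
  assumes "diff_op F" "smooth W" "smooth (G W)"
  shows "((\<lambda>s. F (\<lambda>y. W y + s *\<^sub>R G W y) x) has_vector_derivative dd F G W x) (at 0)"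
proof -
  obtain \<phi> J where \<phi>: "jet_smooth \<phi>" "coord_smooth \<phi>" "finite J" "depends_on J \<phi>"
    "\<forall>W. smooth W \<longrightarrow> F W = (\<lambda>x. \<phi> (jet W x))"
    using assms(1) by (rule diff_opE)
  have "((\<lambda>s. F (\<lambda>y. W y + s *\<^sub>R G W y) x) has_vector_derivative
      (\<Sum>i\<in>J. jet (G W) x i *\<^sub>R coord_deriv i \<phi> (jet W x))) (at 0)"
    using has_vector_derivative_jet_comp[OF \<phi>(2-4) assms(2,3)]
    by (simp add: \<phi>(5) smooth_affine assms)
  then show ?thesis
    unfolding dd_def using vector_derivative_works differentiableI_vector by blast
qed

text \<open>Makes iterated derivatives such as \<open>dd (dd \<Psi>1 \<Gamma>1) \<Gamma>1\<close>
  legitimate operators.\<close>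

lemma diff_op_dd:
  assumes "diff_op F" "diff_op G"
  shows "diff_op (dd F G)"
proof -
  obtain \<phi> J where \<phi>: "jet_smooth \<phi>" "coord_smooth \<phi>" "finite J" "depends_on J \<phi>"
    "\<forall>W. smooth W \<longrightarrow> F W = (\<lambda>x. \<phi> (jet W x))"
    using assms(1) by (rule diff_opE)
  have "dd F G W x = (\<Sum>i\<in>J. jet (G W) x i *\<^sub>R coord_deriv i \<phi> (jet W x))" if "smooth W" for W x
    using has_vector_derivative_jet_comp[OF \<phi>(2-4) that smooth_diff_op[OF assms(2) that]]
    unfolding dd_def
    by (simp add: \<phi>(5) smooth_affine smooth_diff_op[OF assms(2)] that vector_derivative_at)
  then show ?thesis
    by (subst diff_op_cong)
      (assumption, intro diff_op_sum diff_op_scaleR diff_op_jet_comp diff_op_coord_deriv_jet \<phi>(1) assms(2))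
qed

text \<open>The line through a smooth field in a smooth direction stays among smooth fields, so
  values of the operators elsewhere are irrelevant to the derivative.\<close>

lemma dd_cong:
  assumes "\<And>W x. smooth W \<Longrightarrow> F W x = F' W x" "G W = G' W" "smooth W" "smooth (G W)"
  shows "dd F G W x = dd F' G' W x"
  using assms smooth_affine[of W "G W"] by (simp add: dd_def)

lemma dd_add:
  assumes "diff_op F" "diff_op F'" "smooth W" "smooth (G W)"
  shows "dd (\<lambda>W x. F W x + F' W x) G W x = dd F G W x + dd F' G W x"
  unfolding dd_def[of "\<lambda>W x. F W x + F' W x"]
  by (intro vector_derivative_at has_vector_derivative_add dd_has_vector_derivative assms)

lemma dd_bounded_linear:
  assumes "bounded_linear K" "diff_op F" "smooth W" "smooth (G W)"
  shows "dd (\<lambda>W x. K (F W x)) G W x = K (dd F G W x)"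
  unfolding dd_def[of "\<lambda>W x. K (F W x)"]
  by (intro vector_derivative_at bounded_linear.has_vector_derivative[OF assms(1)]
      dd_has_vector_derivative assms)

text \<open>In the jet formula dF.G is linear in the jet of the direction. This extracts the factor
  \<open>- (\<tau> ^ (k - 1))\<close> from a time derivative.\<close>

lemma dd_scale_direction:
  assumes "diff_op F" "smooth W" "smooth (G W)"
  shows "dd F (\<lambda>W x. c *\<^sub>R G W x) W x = c *\<^sub>R dd F G W x"
proof -
  obtain \<phi> J where \<phi>: "jet_smooth \<phi>" "coord_smooth \<phi>" "finite J" "depends_on J \<phi>"
    "\<forall>W. smooth W \<longrightarrow> F W = (\<lambda>x. \<phi> (jet W x))"
    using assms(1) by (rule diff_opE)
  have eq: "dd F H W x = (\<Sum>i\<in>J. jet (H W) x i *\<^sub>R coord_deriv i \<phi> (jet W x))" if "smooth (H W)" for H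
    using has_vector_derivative_jet_comp[OF \<phi>(2-4) assms(2) that]
    unfolding dd_def by (simp add: \<phi>(5) smooth_affine that assms(2) vector_derivative_at)
  have "jet (\<lambda>x. c *\<^sub>R G W x) x p = c * jet (G W) x p" for p
    using jet_affine[OF smooth_const[of 0] assms(3), of c x p] jet_affine[OF smooth_const[of 0] smooth_const[of 0], of 1 x p]
    by simp
  then show ?thesis
    using assms(3) by (simp add: eq smooth_scaleR scaleR_sum_right)
qed

section \<open>The vector space of differential operators\<close>

text \<open>Differential operators on smooth fields form a vector space. Turning it into a type makes
  \<open>A, \<dots>, D, \<Sigma>\<close> and the derivations \<open>F \<mapsto> dF.G\<close> unconditionally linear.\<close>

typedef (overloaded) ('d, 'c, 'b) dop =
  "{F :: (real^'d::finite \<Rightarrow> real^'c::finite) \<Rightarrow> real^'d \<Rightarrow> 'b::real_normed_vector.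
     diff_op F \<and> (\<forall>W. \<not> smooth W \<longrightarrow> F W = (\<lambda>_. 0))}"
  morphisms opr Abs_dop
  by (rule exI[of _ "\<lambda>_ _. 0"]) (simp add: diff_op_const)

text \<open>Resetting the values off smooth fields to zero turns agreement on smooth fields into
  equality in the type. It is meaningful for \<open>diff_op F\<close>, where \<open>Abs_dop\<close>
  is specified.\<close>

definition dop ::
  "((real^'d::finite \<Rightarrow> real^'c::finite) \<Rightarrow> real^'d \<Rightarrow> 'b::real_normed_vector) \<Rightarrow> ('d, 'c, 'b) dop"
  where "dop F = Abs_dop (\<lambda>W. if smooth W then F W else (\<lambda>_. 0))"

lemma diff_op_opr: "diff_op (opr X)"
  using opr[of X] by simp

lemma opr_dop: "diff_op F \<Longrightarrow> smooth W \<Longrightarrow> opr (dop F) W = F W"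
proof -
  assume "diff_op F" "smooth W"
  then have "diff_op (\<lambda>W. if smooth W then F W else (\<lambda>_. 0))"
    by (subst diff_op_cong[of _ F]) auto
  with \<open>smooth W\<close> show ?thesis
    by (simp add: dop_def Abs_dop_inverse)
qed

lemma dop_eqI:
  assumes "\<And>W x. smooth W \<Longrightarrow> opr X W x = opr Z W x"
  shows "X = Z"
proof -
  have "opr X W = opr Z W" for W
    using assms opr[of X] opr[of Z] by (cases "smooth W") auto
  then show ?thesis
    by (simp add: opr_inject[symmetric] ext)
qed

instantiation dop :: (finite, finite, real_normed_vector) real_vector
begin

definition "0 = dop (\<lambda>_ _. 0)"
definition "X + Z = dop (\<lambda>W x. opr X W x + opr Z W x)"
definition "a *\<^sub>R X = dop (\<lambda>W x. a *\<^sub>R opr X W x)"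
definition "- (X :: ('a, 'b, 'c) dop) = (-1) *\<^sub>R X"
definition "X - (Z :: ('a, 'b, 'c) dop) = X + (-1) *\<^sub>R Z"

lemma opr_zero: "smooth W \<Longrightarrow> opr 0 W x = 0"
  by (simp add: zero_dop_def opr_dop diff_op_const)

lemma opr_add: "smooth W \<Longrightarrow> opr (X + Z) W x = opr X W x + opr Z W x"
  by (simp add: plus_dop_def opr_dop diff_op_add diff_op_opr)

lemma opr_scaleR: "smooth W \<Longrightarrow> opr (a *\<^sub>R X) W x = a *\<^sub>R opr X W x"
  by (simp add: scaleR_dop_def opr_dop diff_op_bounded_linear[OF bounded_linear_scaleR_right] diff_op_opr)

lemma opr_uminus: "smooth W \<Longrightarrow> opr (- X) W x = - opr X W x"
  by (simp add: uminus_dop_def opr_scaleR)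

lemma opr_diff: "smooth W \<Longrightarrow> opr (X - Z) W x = opr X W x - opr Z W x"
  by (simp add: minus_dop_def opr_scaleR opr_add)

instance
  by standard
    (auto intro!: dop_eqI simp: opr_zero opr_add opr_scaleR opr_uminus opr_diff scaleR_add_right scaleR_add_left)

end

lemmas opr_simps = opr_zero opr_add opr_scaleR opr_uminus opr_diff

lemma opr_add_fun: "smooth W \<Longrightarrow> opr (X + Z) W = (\<lambda>x. opr X W x + opr Z W x)"
  by (rule ext) (rule opr_add)

section \<open>First-order operators with constant coefficients\<close>

text \<open>The zeroth-order term \<open>K\<^sub>0\<close> lets the constant matrix behind
  \<open>Sig\<close> share one theory with the blocks of \<Lambda>.\<close>

definition first_order :: "((real^'d::finite \<Rightarrow> 'a::real_normed_vector) \<Rightarrow> real^'d \<Rightarrow> 'b::real_normed_vector) \<Rightarrow> bool" where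
  "first_order L \<longleftrightarrow> (\<exists>K\<^sub>0 K. bounded_linear K\<^sub>0 \<and> (\<forall>\<alpha>. bounded_linear (K \<alpha>)) \<and>
     (\<forall>u x. smooth u \<longrightarrow> L u x = K\<^sub>0 (u x) + (\<Sum>\<alpha>\<in>UNIV. K \<alpha> (pd \<alpha> u x))))"

lemma first_orderE:
  assumes "first_order L"
  obtains K0 K where "bounded_linear K0" "\<forall>\<alpha>. bounded_linear (K \<alpha>)"
    "\<forall>u. smooth u \<longrightarrow> L u = (\<lambda>x. K0 (u x) + (\<Sum>\<alpha>\<in>UNIV. K \<alpha> (pd \<alpha> u x)))"
proof -
  obtain K0 K where "bounded_linear K0" "\<forall>\<alpha>. bounded_linear (K \<alpha>)"
    "\<forall>u x. smooth u \<longrightarrow> L u x = K0 (u x) + (\<Sum>\<alpha>\<in>UNIV. K \<alpha> (pd \<alpha> u x))"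
    using assms unfolding first_order_def by blast
  then show ?thesis
    by (intro that[of K0 K]) auto
qed

lemma first_order_bounded_linear: "bounded_linear K \<Longrightarrow> first_order (\<lambda>u x. K (u x))"
  unfolding first_order_def
  by (rule exI[of _ K], rule exI[of _ "\<lambda>_ _. 0"]) simp

lemma first_order_smooth:
  assumes "first_order L" "smooth u"
  shows "smooth (L u)"
  using assms(1)
proof (rule first_orderE)
  fix K0 K
  assume K: "bounded_linear K0" "\<forall>\<alpha>. bounded_linear (K \<alpha>)"
    "\<forall>u. smooth u \<longrightarrow> L u = (\<lambda>x. K0 (u x) + (\<Sum>\<alpha>\<in>UNIV. K \<alpha> (pd \<alpha> u x)))"
  show ?thesis
    unfolding K(3)[rule_format, OF assms(2)]
    by (intro smooth_add smooth_sum smooth_bounded_linear[OF K(1)]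
        smooth_bounded_linear[OF K(2)[rule_format]] smooth_pd assms(2))
qed

lemma first_order_add:
  assumes "first_order L" "smooth u" "smooth w"
  shows "L (\<lambda>x. u x + w x) x = L u x + L w x"
  using assms(1)
proof (rule first_orderE)
  fix K0 K
  assume K: "bounded_linear K0" "\<forall>\<alpha>. bounded_linear (K \<alpha>)"
    "\<forall>u. smooth u \<longrightarrow> L u = (\<lambda>x. K0 (u x) + (\<Sum>\<alpha>\<in>UNIV. K \<alpha> (pd \<alpha> u x)))"
  then show ?thesis
    using assms(2,3)
    by (simp add: smooth_add[of u w] pd_add linear_simps(1)[OF K(1)] linear_simps(1)[OF K(2)[rule_format]] sum.distrib)
qed

lemma first_order_bounded_linear_comp:
  assumes "first_order L" "bounded_linear H"
  shows "first_order (\<lambda>u x. H (L u x))"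
  using assms(1)
proof (rule first_orderE)
  fix K0 K
  assume K: "bounded_linear K0" "\<forall>\<alpha>. bounded_linear (K \<alpha>)"
    "\<forall>u. smooth u \<longrightarrow> L u = (\<lambda>x. K0 (u x) + (\<Sum>\<alpha>\<in>UNIV. K \<alpha> (pd \<alpha> u x)))"
  then show ?thesis
    unfolding first_order_def
    by (intro exI[of _ "\<lambda>z. H (K0 z)"] exI[of _ "\<lambda>\<alpha> z. H (K \<alpha> z)"])
      (simp add: K bounded_linear_compose[OF assms(2)] linear_simps(1)[OF assms(2)]
        linear_sum[OF bounded_linear.linear[OF assms(2)]])
qed

lemma first_order_comp_bounded_linear:
  assumes "first_order L" "bounded_linear H"
  shows "first_order (\<lambda>u. L (\<lambda>x. H (u x)))"
  using assms(1)
proof (rule first_orderE)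
  fix K0 K
  assume K: "bounded_linear K0" "\<forall>\<alpha>. bounded_linear (K \<alpha>)"
    "\<forall>u. smooth u \<longrightarrow> L u = (\<lambda>x. K0 (u x) + (\<Sum>\<alpha>\<in>UNIV. K \<alpha> (pd \<alpha> u x)))"
  then show ?thesis
    unfolding first_order_def
    by (intro exI[of _ "\<lambda>z. K0 (H z)"] exI[of _ "\<lambda>\<alpha> z. K \<alpha> (H z)"])
      (simp add: K bounded_linear_compose[OF _ assms(2)] smooth_bounded_linear[OF assms(2)]
        pd_bounded_linear[OF assms(2)])
qed

lemma first_order_scaleR:
  assumes "first_order L" "smooth u"
  shows "L (\<lambda>x. a *\<^sub>R u x) x = a *\<^sub>R L u x"
  using assms(1)
proof (rule first_orderE)
  fix K0 K
  assume K: "bounded_linear K0" "\<forall>\<alpha>. bounded_linear (K \<alpha>)"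
    "\<forall>u. smooth u \<longrightarrow> L u = (\<lambda>x. K0 (u x) + (\<Sum>\<alpha>\<in>UNIV. K \<alpha> (pd \<alpha> u x)))"
  then show ?thesis
    using assms(2)
    by (simp add: smooth_scaleR pd_bounded_linear[OF bounded_linear_scaleR_right]
        linear_simps(5)[OF K(1)] linear_simps(5)[OF K(2)[rule_format]] scaleR_sum_right scaleR_add_right)
qed

lemma first_order_diff_op:
  assumes "first_order L" "diff_op F"
  shows "diff_op (\<lambda>W. L (F W))"
  using assms(1)
proof (rule first_orderE)
  fix K0 K
  assume K: "bounded_linear K0" "\<forall>\<alpha>. bounded_linear (K \<alpha>)"
    "\<forall>u. smooth u \<longrightarrow> L u = (\<lambda>x. K0 (u x) + (\<Sum>\<alpha>\<in>UNIV. K \<alpha> (pd \<alpha> u x)))"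
  let ?G = "\<lambda>W x. K0 (F W x) + (\<Sum>\<alpha>\<in>UNIV. K \<alpha> (pd \<alpha> (F W) x))"
  have "diff_op ?G"
    by (intro diff_op_add diff_op_sum diff_op_bounded_linear[OF K(1)]
        diff_op_bounded_linear[OF K(2)[rule_format]] diff_op_pd assms(2))
  moreover have "L (F W) x = ?G W x" if "smooth W" for W x
    using K(3) smooth_diff_op[OF assms(2) that] by simp
  ultimately show ?thesis
    by (subst diff_op_cong[where G = ?G])
qed

text \<open>Stated for scalar operators, the objects on which time derivations act. It is kept as a
  property of the direction \<open>G\<close> and later inherited from the commutation of a time
  derivation with spatial derivatives.\<close>

definition dd_commutes ::
  "((real^'d::finite \<Rightarrow> real^'c::finite) \<Rightarrow> real^'d \<Rightarrow> real^'c) \<Rightarrow> bool" where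
  "dd_commutes G \<longleftrightarrow> (\<forall>F :: (real^'d \<Rightarrow> real^'c) \<Rightarrow> real^'d \<Rightarrow> real. \<forall>\<alpha> W x. diff_op F \<longrightarrow> smooth W \<longrightarrow>
     dd (\<lambda>W. pd \<alpha> (F W)) G W x = pd \<alpha> (dd F G W) x)"

text \<open>Taking a component is bounded linear, hence commutes with both derivatives and reduces
  the vector case to scalars.\<close>

lemma dd_pd:
  fixes F :: "(real^'d::finite \<Rightarrow> real^'c::finite) \<Rightarrow> real^'d \<Rightarrow> real^'m::finite"
  assumes "dd_commutes G" "diff_op F" "smooth W" "diff_op G"
  shows "dd (\<lambda>W. pd \<alpha> (F W)) G W x = pd \<alpha> (dd F G W) x"
proof (rule vec_eq_iff[THEN iffD2, rule_format])
  fix i :: 'm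
  let ?Fi = "\<lambda>W x. F W x $ i"
  note G = smooth_diff_op[OF assms(4,3)]
  note nth = bounded_linear_vec_nth
  have Fi: "diff_op ?Fi"
    by (rule diff_op_bounded_linear[OF nth assms(2)])
  have "dd (\<lambda>W. pd \<alpha> (F W)) G W x $ i = dd (\<lambda>W x. pd \<alpha> (F W) x $ i) G W x"
    by (rule dd_bounded_linear[where K = "\<lambda>z. z $ i", symmetric])
      (intro nth diff_op_pd assms G)+
  also have "\<dots> = dd (\<lambda>W. pd \<alpha> (?Fi W)) G W x"
    by (rule dd_cong) (simp_all add: pd_bounded_linear[OF nth] smooth_diff_op[OF assms(2)] assms(3) G)
  also have "\<dots> = pd \<alpha> (dd ?Fi G W) x"
    using assms(1,3) Fi unfolding dd_commutes_def by blast
  also have "dd ?Fi G W = (\<lambda>x. dd F G W x $ i)"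
    by (rule ext) (rule dd_bounded_linear[where K = "\<lambda>z. z $ i" and G = G and F = F, OF nth assms(2,3) G])
  also have "pd \<alpha> \<dots> x = pd \<alpha> (dd F G W) x $ i"
    by (rule pd_bounded_linear[OF nth smooth_diff_op[OF diff_op_dd[OF assms(2,4)] assms(3)]])
  finally show "dd (\<lambda>W. pd \<alpha> (F W)) G W x $ i = pd \<alpha> (dd F G W) x $ i" .
qed

lemma dd_zero: "dd (\<lambda>_ _. 0) G W x = 0"
  by (simp add: dd_def)

lemma dd_sum:
  assumes "\<And>i. i \<in> I \<Longrightarrow> diff_op (F i)" "smooth W" "smooth (G W)"
  shows "dd (\<lambda>W x. \<Sum>i\<in>I. F i W x) G W x = (\<Sum>i\<in>I. dd (F i) G W x)"
  using assms(1)
proof (induction I rule: infinite_finite_induct)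
  case (insert i I)
  then show ?case
    by (simp add: dd_add[where F = "F i"] diff_op_sum assms(2,3))
qed (auto simp: dd_zero)

lemma dd_first_order:
  fixes F :: "(real^'d::finite \<Rightarrow> real^'c::finite) \<Rightarrow> real^'d \<Rightarrow> real^'m::finite"
  assumes "first_order L" "dd_commutes G" "diff_op F" "smooth W" "diff_op G"
  shows "dd (\<lambda>W. L (F W)) G W x = L (dd F G W) x"
  using assms(1)
proof (rule first_orderE)
  fix K0 K
  assume K: "bounded_linear K0" "\<forall>\<alpha>. bounded_linear (K \<alpha>)"
    "\<forall>u. smooth u \<longrightarrow> L u = (\<lambda>x. K0 (u x) + (\<Sum>\<alpha>\<in>UNIV. K \<alpha> (pd \<alpha> u x)))"
  note G = smooth_diff_op[OF assms(5,4)]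
  have Kp: "diff_op (\<lambda>W x. K \<alpha> (pd \<alpha> (F W) x))" for \<alpha>
    by (rule diff_op_bounded_linear[OF K(2)[rule_format] diff_op_pd[OF assms(3)]])
  have "dd (\<lambda>W. L (F W)) G W x = dd (\<lambda>W x. K0 (F W x) + (\<Sum>\<alpha>\<in>UNIV. K \<alpha> (pd \<alpha> (F W) x))) G W x"
    by (rule dd_cong) (simp_all add: K(3) smooth_diff_op[OF assms(3)] assms(4) G)
  also have "\<dots> = K0 (dd F G W x) + (\<Sum>\<alpha>\<in>UNIV. K \<alpha> (pd \<alpha> (dd F G W) x))"
    by (simp add: assms(2-5) G K(1) K(2)[rule_format] Kp dd_sum dd_pd diff_op_pd diff_op_sum
        dd_add[where F = "\<lambda>W x. K0 (F W x)" and F' = "\<lambda>W x. \<Sum>\<alpha>\<in>UNIV. K \<alpha> (pd \<alpha> (F W) x)"]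
        dd_bounded_linear[where K = K0] dd_bounded_linear[where K = "K _"]
        diff_op_bounded_linear[where K = K0])
  also have "\<dots> = L (dd F G W) x"
    using K(3) smooth_diff_op[OF diff_op_dd[OF assms(3,5)] assms(4)] by simp
  finally show ?thesis .
qed

section \<open>Lifting operators and derivations to linear maps on the vector space\<close>

definition lift_field :: "((real^'d::finite \<Rightarrow> real^'m::finite) \<Rightarrow> real^'d \<Rightarrow> real^'n::finite) \<Rightarrow>
    ('d, 'c::finite, real^'m) dop \<Rightarrow> ('d, 'c, real^'n) dop" where
  "lift_field L X = dop (\<lambda>W. L (opr X W))"

definition lift_dd :: "((real^'d::finite \<Rightarrow> real^'c::finite) \<Rightarrow> real^'d \<Rightarrow> real^'c) \<Rightarrow>
    ('d, 'c, real^'m::finite) dop \<Rightarrow> ('d, 'c, real^'m) dop" where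
  "lift_dd G X = dop (dd (opr X) G)"

lemma opr_lift_field: "first_order L \<Longrightarrow> smooth W \<Longrightarrow> opr (lift_field L X) W = L (opr X W)"
  by (simp add: lift_field_def opr_dop first_order_diff_op diff_op_opr)

lemma opr_lift_dd: "diff_op G \<Longrightarrow> smooth W \<Longrightarrow> opr (lift_dd G X) W = dd (opr X) G W"
  by (simp add: lift_dd_def opr_dop diff_op_dd diff_op_opr)

lemma linear_lift_field:
  assumes "first_order L"
  shows "linear (lift_field L)"
proof (rule linearI; rule dop_eqI)
  fix X Z :: "('a, 'd, real^'b) dop" and a W x
  assume W: "smooth (W :: real^'a \<Rightarrow> real^'d)"
  note s = smooth_diff_op[OF diff_op_opr W]
  show "opr (lift_field L (X + Z)) W x = opr (lift_field L X + lift_field L Z) W x"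
    by (simp add: opr_lift_field[OF assms W] opr_simps W opr_add[OF W, abs_def] first_order_add[OF assms s s])
  show "opr (lift_field L (a *\<^sub>R X)) W x = opr (a *\<^sub>R lift_field L X) W x"
    by (simp add: opr_lift_field[OF assms W] opr_simps W opr_scaleR[OF W, abs_def] first_order_scaleR[OF assms s])
qed

lemma linear_lift_dd:
  assumes "diff_op G"
  shows "linear (lift_dd G)"
proof (rule linearI; rule dop_eqI)
  fix X Z :: "('a, 'b, real^'c) dop" and a W x
  assume W: "smooth (W :: real^'a \<Rightarrow> real^'b)"
  note s = smooth_diff_op[OF assms W]
  have "dd (opr (X + Z)) G W x = dd (\<lambda>W x. opr X W x + opr Z W x) G W x"
    by (rule dd_cong) (simp_all add: opr_simps W s)
  then show "opr (lift_dd G (X + Z)) W x = opr (lift_dd G X + lift_dd G Z) W x"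
    by (simp add: opr_lift_dd[OF assms W] opr_simps W dd_add diff_op_opr s)
  have "dd (opr (a *\<^sub>R X)) G W x = dd (\<lambda>W x. a *\<^sub>R opr X W x) G W x"
    by (rule dd_cong) (simp_all add: opr_simps W s)
  then show "opr (lift_dd G (a *\<^sub>R X)) W x = opr (a *\<^sub>R lift_dd G X) W x"
    by (simp add: opr_lift_dd[OF assms W] opr_simps W s diff_op_opr
        dd_bounded_linear[OF bounded_linear_scaleR_right])
qed

text \<open>Supplies the commutation rules between derivations and the maps A, B, C, D and \<Sigma>
  in the abstract setting.\<close>

lemma lift_dd_lift_field:
  fixes X :: "('d::finite, 'c::finite, real^'m::finite) dop"
    and L :: "(real^'d \<Rightarrow> real^'m) \<Rightarrow> real^'d \<Rightarrow> real^'n::finite"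
  assumes "first_order L" "dd_commutes G" "diff_op G"
  shows "lift_dd G (lift_field L X) = lift_field L (lift_dd G X)"
proof (rule dop_eqI)
  fix W :: "real^'d \<Rightarrow> real^'c" and x
  assume W: "smooth W"
  have "dd (opr (lift_field L X)) G W x = dd (\<lambda>W. L (opr X W)) G W x"
    by (rule dd_cong) (simp_all add: opr_lift_field assms W smooth_diff_op)
  then show "opr (lift_dd G (lift_field L X)) W x = opr (lift_field L (lift_dd G X)) W x"
    by (simp add: opr_lift_dd opr_lift_field assms W dd_first_order diff_op_opr)
qed

section \<open>The Chapman-Enskog expansion in abstract form\<close>

text \<open>Applying an arbitrary functional reduces the vector identities below to real linear arithmetic.\<close>

lemma linear_functional_eqI:
  fixes x y :: "'a::real_vector"
  assumes "\<And>f :: 'a \<Rightarrow> real. linear f \<Longrightarrow> f x = f y"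
  shows "x = y"
proof (rule ccontr)
  assume "x \<noteq> y"
  then have "independent {x - y}"
    by simp
  then obtain f :: "'a \<Rightarrow> real" where f: "linear f" "\<forall>z\<in>{x - y}. f z = 1"
    using linear_independent_extend[of "{x - y}" "\<lambda>_. 1"] by blast
  then have "f x - f y = 1"
    using linear_diff[OF f(1), of x y] by simp
  then show False
    using assms[OF f(1)] by simp
qed

definition exp_series :: "((nat \<Rightarrow> 'z) \<Rightarrow> nat \<Rightarrow> 'z) \<Rightarrow> (nat \<Rightarrow> 'z) \<Rightarrow> nat \<Rightarrow> 'z::real_vector" where
  "exp_series E m n = (\<Sum>k\<le>n. (1 / fact k) *\<^sub>R (E ^^ k) m n)"

text \<open>\<open>'u\<close> and \<open>'v\<close> stand for the operators with conserved and
  nonconserved values, \<open>W\<close> for the identity operator, \<open>P 0\<close> for the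
  equilibrium and \<open>P n\<close> for the correction of order \<open>n\<close>. The maps
  \<open>d k\<close> and \<open>e k\<close> model the one derivation along the k-th coefficient,
  once on each space.\<close>

locale chapman_enskog =
  fixes A :: "'u::real_vector \<Rightarrow> 'u" and B :: "'v::real_vector \<Rightarrow> 'u" and C :: "'u \<Rightarrow> 'v"
    and D \<Sigma> :: "'v \<Rightarrow> 'v" and d :: "nat \<Rightarrow> 'u \<Rightarrow> 'u" and e :: "nat \<Rightarrow> 'v \<Rightarrow> 'v"
    and W :: 'u and P :: "nat \<Rightarrow> 'v"
  assumes lin: "linear A" "linear B" "linear C" "linear D" "linear \<Sigma>"
    "\<And>k. linear (d k)" "\<And>k. linear (e k)"
begin

text \<open>The nonconserved part of the moments before (\<open>c = 1/2\<close>) and after (\<open>c = - 1/2\<close>) relaxation.\<close>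

definition moments where
  "moments c n = (if n = 0 then (W, P 0) else (0, \<Sigma> (P n) + c *\<^sub>R P n))"

text \<open>The minus sign arises because \<open>d k\<close> stands for the derivative along the
  k-th coefficient, the opposite of the rescaled time derivative.\<close>

definition dt where
  "dt m n = - (\<Sum>k=1..n. (d k (fst (m (n - k))), e k (snd (m (n - k)))))"

definition adv where
  "adv m n = (if n = 0 then 0
     else - (A (fst (m (n - 1))) + B (snd (m (n - 1))), C (fst (m (n - 1))) + D (snd (m (n - 1)))))"

text \<open>Relates a derivation to spatial operators and constant matrices only. Nothing relates
  two different derivations, so the order of \<open>d j\<close> and \<open>d k\<close> is respected
  throughout.\<close>

definition commutes where
  "commutes k \<longleftrightarrow> (\<forall>u. d k (A u) = A (d k u)) \<and> (\<forall>y. d k (B y) = B (e k y)) \<and>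
     (\<forall>u. e k (C u) = C (d k u)) \<and> (\<forall>y. e k (D y) = D (e k y)) \<and> (\<forall>y. e k (\<Sigma> y) = \<Sigma> (e k y))"

lemmas lins = lin[THEN linear_add] lin[THEN linear_scale] lin[THEN linear_diff] lin[THEN linear_neg]
  lin[THEN linear_0]

lemmas functional_simps = linear_add linear_scale linear_diff linear_neg linear_0

lemmas series_simps = exp_series_def moments_def dt_def adv_def sum.atLeast_Suc_atMost sum.atMost_Suc
  numeral_eq_Suc fact_Suc lins

abbreviation "B2 y \<equiv> A (B y) + B (D y)"
abbreviation "D2 y \<equiv> C (B y) + D (D y)"

text \<open>The derivative of the identity in a direction is that direction, so \<open>d n W\<close>
  represents the n-th coefficient and \<open>e n (P 0)\<close> the derivative of the equilibrium
  along it.\<close>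

definition "Gamma_eq1 \<longleftrightarrow> d 1 W = A W + B (P 0)"
definition "Psi_eq1 \<longleftrightarrow> P 1 = e 1 (P 0) - (C W + D (P 0))"
definition "Gamma_eq2 \<longleftrightarrow> d 2 W = B (\<Sigma> (P 1))"
definition "Psi_eq2 \<longleftrightarrow> P 2 = \<Sigma> (e 1 (P 1)) + e 2 (P 0) - D (\<Sigma> (P 1))"
definition "Gamma_eq3 \<longleftrightarrow> d 3 W = B (\<Sigma> (P 2)) - (1/6) *\<^sub>R B (e 1 (P 1)) + (1/12) *\<^sub>R B2 (P 1)"
definition "Psi_eq3 \<longleftrightarrow> P 3 = \<Sigma> (e 2 (P 1)) + e 3 (P 0) - D (\<Sigma> (P 2)) + \<Sigma> (e 1 (P 2))
  + (1/6) *\<^sub>R D (e 1 (P 1)) - (1/12) *\<^sub>R D2 (P 1) - (1/12) *\<^sub>R e 1 (e 1 (P 1))"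
definition "Gamma_eq4 \<longleftrightarrow> d 4 W = B (\<Sigma> (P 3)) + (1/4) *\<^sub>R B2 (P 2) + (1/6) *\<^sub>R B (D2 (\<Sigma> (P 1)))
  - (1/6) *\<^sub>R A (B (P 2)) - (1/6) *\<^sub>R B (e 2 (e 1 (P 0))) - (1/6) *\<^sub>R B (e 1 (e 2 (P 0)))
  - (1/6) *\<^sub>R B (\<Sigma> (e 1 (e 1 (P 1))))"

abbreviation "cons_eq n \<equiv> fst (exp_series dt (moments (1/2)) n) = fst (exp_series adv (moments (-1/2)) n)"
abbreviation "noncons_eq n \<equiv> snd (exp_series dt (moments (1/2)) n) = snd (exp_series adv (moments (-1/2)) n)"

lemma e1: "Psi_eq1 \<Longrightarrow> e 1 (P 0) = P 1 + (C W + D (P 0))"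
  by (simp add: Psi_eq1_def)
lemma e2: "Psi_eq2 \<Longrightarrow> e 2 (P 0) = P 2 - \<Sigma> (e 1 (P 1)) + D (\<Sigma> (P 1))"
  by (simp add: Psi_eq2_def)
lemma e3: "Psi_eq3 \<Longrightarrow> e 3 (P 0) = P 3 - \<Sigma> (e 2 (P 1)) + D (\<Sigma> (P 2)) - \<Sigma> (e 1 (P 2))
  - (1/6) *\<^sub>R D (e 1 (P 1)) + (1/12) *\<^sub>R D2 (P 1) + (1/12) *\<^sub>R e 1 (e 1 (P 1))"
  by (simp add: Psi_eq3_def)

text \<open>The conserved equations are verified instead of solved: with \<open>d n\<close> the
  derivation along the explicit formula, they show that this formula solves the order
  \<open>n\<close> equation. Uniqueness follows later, as the unknown time derivative enters
  affinely.\<close>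

lemma cons_eq_1: "Gamma_eq1 \<Longrightarrow> cons_eq 1"
  by (simp add: series_simps Gamma_eq1_def)

lemma noncons_eq_1:
  assumes "noncons_eq 1"
  shows Psi_eq1
  unfolding Psi_eq1_def
proof (rule linear_functional_eqI)
  fix f :: "'v \<Rightarrow> real" assume f: "linear f"
  show "f (P 1) = f (e 1 (P 0) - (C W + D (P 0)))"
    using arg_cong[OF assms, of f]
    by (simp add: series_simps functional_simps[OF f])
qed

text \<open>Pulling \<open>d 1\<close> through A and B gives \<open>d 1 (d 1 W)\<close> as the
  square of \<Lambda> applied to \<open>(W, P 0)\<close>, first component, plus
  \<open>B (P 1)\<close>. Half of this extra term cancels the half from relaxation.\<close>

lemma cons_eq_2:
  assumes "commutes 1" Gamma_eq1 Psi_eq1 Gamma_eq2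
  shows "cons_eq 2"
proof (rule linear_functional_eqI)
  fix f :: "'u \<Rightarrow> real" assume f: "linear f"
  note e = e1[OF assms(3)]
  show "f (fst (exp_series dt (moments (1/2)) 2)) = f (fst (exp_series adv (moments (-1/2)) 2))"
    using assms(1,2,4) e
    by (simp add: Gamma_eq1_def Gamma_eq2_def series_simps functional_simps[OF f] commutes_def)
qed

lemma noncons_eq_2:
  assumes "commutes 1" Gamma_eq1 Psi_eq1 Gamma_eq2 "noncons_eq 2"
  shows Psi_eq2
  unfolding Psi_eq2_def
proof (rule linear_functional_eqI)
  fix f :: "'v \<Rightarrow> real" assume f: "linear f"
  note e = e1[OF assms(3)]
  show "f (P 2) = f (\<Sigma> (e 1 (P 1)) + e 2 (P 0) - D (\<Sigma> (P 1)))"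
    using assms(1,2,4) e arg_cong[OF assms(5), of f]
    by (simp add: Gamma_eq1_def Gamma_eq2_def series_simps functional_simps[OF f] commutes_def add_divide_distrib diff_divide_distrib)
qed

text \<open>In \<open>d 1 (d 2 W) + d 2 (d 1 W)\<close> the terms with
  \<open>\<Sigma> (e 1 (P 1))\<close> cancel, leaving \<open>B2 (\<Sigma> (P 1)) + B (P 2)\<close>.
  The coefficient 1/12 is 1/4 - 1/6, from the halved relaxation term and the cubic terms.\<close>

lemma cons_eq_3:
  assumes "commutes 1" "commutes 2" Gamma_eq1 Psi_eq1 Gamma_eq2 Psi_eq2 Gamma_eq3
  shows "cons_eq 3"
proof (rule linear_functional_eqI)
  fix f :: "'u \<Rightarrow> real" assume f: "linear f"
  note e = e1[OF assms(4)] e2[OF assms(6)]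
  show "f (fst (exp_series dt (moments (1/2)) 3)) = f (fst (exp_series adv (moments (-1/2)) 3))"
    using assms(1,2,3,5,7) e
    by (simp add: Gamma_eq1_def Gamma_eq2_def Gamma_eq3_def series_simps functional_simps[OF f] commutes_def add_divide_distrib diff_divide_distrib)
qed

lemma noncons_eq_3:
  assumes "commutes 1" "commutes 2" Gamma_eq1 Psi_eq1 Gamma_eq2 Psi_eq2 Gamma_eq3 "noncons_eq 3"
  shows Psi_eq3
  unfolding Psi_eq3_def
proof (rule linear_functional_eqI)
  fix f :: "'v \<Rightarrow> real" assume f: "linear f"
  note e = e1[OF assms(4)] e2[OF assms(6)]
  show "f (P 3) = f (\<Sigma> (e 2 (P 1)) + e 3 (P 0) - D (\<Sigma> (P 2)) + \<Sigma> (e 1 (P 2))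
  + (1/6) *\<^sub>R D (e 1 (P 1)) - (1/12) *\<^sub>R D2 (P 1) - (1/12) *\<^sub>R e 1 (e 1 (P 1)))"
    using assms(1,2,3,5,7) e arg_cong[OF assms(8), of f]
    by (simp add: Gamma_eq1_def Gamma_eq2_def Gamma_eq3_def series_simps functional_simps[OF f] commutes_def add_divide_distrib diff_divide_distrib)
qed

text \<open>The word \<open>d 3 (d 1 W)\<close> produces \<open>B (e 3 (P 0))\<close>, so the
  formula for \<open>P 3\<close> is used already for the fourth coefficient.\<close>

lemma cons_eq_4:
  assumes "commutes 1" "commutes 2" "commutes 3" Gamma_eq1 Psi_eq1 Gamma_eq2 Psi_eq2 Gamma_eq3 Psi_eq3 Gamma_eq4
  shows "cons_eq 4"
proof (rule linear_functional_eqI)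
  fix f :: "'u \<Rightarrow> real" assume f: "linear f"
  note e = e1[OF assms(5)] e2[OF assms(7)] e3[OF assms(9)]
  show "f (fst (exp_series dt (moments (1/2)) 4)) = f (fst (exp_series adv (moments (-1/2)) 4))"
    using assms(1-4,6,8,10) e
    by (simp add: Gamma_eq1_def Gamma_eq2_def Gamma_eq3_def Gamma_eq4_def series_simps functional_simps[OF f] commutes_def add_divide_distrib diff_divide_distrib)
qed
end

section \<open>The block operators and the coefficient operators\<close>

lemma bounded_linear_cons: "bounded_linear (cons :: real^('c::finite + 'y::finite) \<Rightarrow> real^'c)"
  unfolding linear_conv_bounded_linear[symmetric]
  by (rule linearI) (simp_all add: cons_def vec_eq_iff)

lemma bounded_linear_noncons: "bounded_linear (noncons :: real^('c::finite + 'y::finite) \<Rightarrow> real^'y)"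
  unfolding linear_conv_bounded_linear[symmetric]
  by (rule linearI) (simp_all add: noncons_def vec_eq_iff)

lemma bounded_linear_mjoin_left:
  "bounded_linear (\<lambda>w. mjoin w 0 :: real^('c::finite + 'y::finite))"
  unfolding linear_conv_bounded_linear[symmetric]
  by (rule linearI) (simp_all add: mjoin_def vec_eq_iff split: sum.split)

lemma bounded_linear_mjoin_right:
  "bounded_linear (\<lambda>w. mjoin 0 w :: real^('c::finite + 'y::finite))"
  unfolding linear_conv_bounded_linear[symmetric]
  by (rule linearI) (simp_all add: mjoin_def vec_eq_iff split: sum.split)

lemma cons_mjoin [simp]: "cons (mjoin a b) = a"
  and noncons_mjoin [simp]: "noncons (mjoin a b) = b"
  by (simp_all add: cons_def noncons_def mjoin_def)

lemma mjoin_cons_noncons [simp]: "mjoin (cons m) (noncons m) = m"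
  by (simp add: cons_def noncons_def mjoin_def vec_eq_iff split: sum.split)

lemma mjoin_add: "mjoin a b + mjoin a' b' = mjoin (a + a') (b + b')"
  and mjoin_scaleR: "c *\<^sub>R mjoin a b = mjoin (c *\<^sub>R a) (c *\<^sub>R b)"
  by (simp_all add: mjoin_def vec_eq_iff split: sum.split)

lemma first_order_Lam:
  fixes v :: "'q::finite \<Rightarrow> real^'d::finite" and M :: "real^'q^'m::finite"
  shows "first_order (Lam v M)"
proof -
  \<comment> \<open>The matrix of the coefficient of the derivative in direction \<alpha>, namely M
    diag(v_j^\<alpha>) M^-1.\<close>
  define K where "K \<alpha> z = M *v (\<chi> j. v j $ \<alpha> * (matrix_inv M *v z) $ j)" for \<alpha> z
  have Minv: "bounded_linear (\<lambda>z. (matrix_inv M *v z) $ j)" for j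
    by (rule bounded_linear_compose[OF bounded_linear_vec_nth matrix_vector_mul_bounded_linear])
  have "bounded_linear (K \<alpha>)" for \<alpha>
  proof -
    have "linear (\<lambda>z. \<chi> j. v j $ \<alpha> * (matrix_inv M *v z) $ j)"
      by (rule linearI) (simp_all add: vec_eq_iff matrix_vector_right_distrib
          vector_scaleR_matrix_ac matrix_vector_mult_scaleR algebra_simps)
    then show ?thesis
      unfolding K_def[abs_def] linear_conv_bounded_linear
      by (rule bounded_linear_compose[OF matrix_vector_mul_bounded_linear])
  qed
  moreover have "Lam v M u x = 0 + (\<Sum>\<alpha>\<in>UNIV. K \<alpha> (pd \<alpha> u x))" if "smooth u" for u x
  proof -
    have "(\<chi> j. \<Sum>\<alpha>\<in>UNIV. v j $ \<alpha> * pd \<alpha> (\<lambda>y. (matrix_inv M *v u y) $ j) x) =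
        (\<Sum>\<alpha>\<in>UNIV. \<chi> j. v j $ \<alpha> * (matrix_inv M *v pd \<alpha> u x) $ j)"
      by (simp add: vec_eq_iff pd_bounded_linear[OF Minv that])
    then show ?thesis
      unfolding Lam_def K_def by (simp add: linear_sum[OF matrix_vector_mul_linear])
  qed
  ultimately show ?thesis
    unfolding first_order_def by (intro exI[of _ "\<lambda>_. 0"] exI[of _ K]) simp
qed

lemma first_order_blocks:
  fixes v :: "'q::finite \<Rightarrow> real^'d::finite" and M :: "real^'q^('c::finite + 'y::finite)"
  shows "first_order (lbm.A v M)" "first_order (lbm.B v M)"
    "first_order (lbm.C v M)" "first_order (lbm.D v M)"
  unfolding lbm.A_def lbm.B_def lbm.C_def lbm.D_def
    block_cc_def[abs_def] block_cn_def[abs_def] block_nc_def[abs_def] block_nn_def[abs_def]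
  by (rule first_order_bounded_linear_comp[OF first_order_comp_bounded_linear[OF first_order_Lam]],
      rule bounded_linear_mjoin_left bounded_linear_mjoin_right,
      rule bounded_linear_cons bounded_linear_noncons)+

text \<open>The block form of \<Lambda>, by splitting a moment field into its conserved and
  nonconserved parts. It matches \<Lambda> with the abstract advection step.\<close>

lemma Lam_mjoin:
  fixes v :: "'q::finite \<Rightarrow> real^'d::finite" and M :: "real^'q^('c::finite + 'y::finite)"
  assumes "smooth u" "smooth w"
  shows "Lam v M (\<lambda>x. mjoin (u x) (w x)) x =
    mjoin (lbm.A v M u x + lbm.B v M w x) (lbm.C v M u x + lbm.D v M w x)"
proof -
  have "Lam v M (\<lambda>x. mjoin (u x) (w x)) x = Lam v M (\<lambda>x. mjoin (u x) 0 + mjoin 0 (w x)) x"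
    by (simp add: mjoin_add)
  also have "\<dots> = Lam v M (\<lambda>x. mjoin (u x) 0) x + Lam v M (\<lambda>x. mjoin 0 (w x)) x"
    by (intro first_order_add[OF first_order_Lam] smooth_bounded_linear[OF bounded_linear_mjoin_left]
        smooth_bounded_linear[OF bounded_linear_mjoin_right] assms)
  also have "\<dots> = mjoin (lbm.A v M u x) (lbm.C v M u x) + mjoin (lbm.B v M w x) (lbm.D v M w x)"
    by (simp add: lbm.A_def lbm.B_def lbm.C_def lbm.D_def block_cc_def block_cn_def block_nc_def block_nn_def)
  finally show ?thesis
    by (simp add: mjoin_add)
qed

section \<open>The explicit coefficients are differential operators\<close>

context lbm
begin

lemma first_order_Sig: "first_order Sig"
  unfolding Sig_def[abs_def] by (rule first_order_bounded_linear) (rule matrix_vector_mul_bounded_linear)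

lemmas first_order_lbm = first_order_blocks[of v M] first_order_Sig

lemma B2_D2_eq:
  assumes "smooth u"
  shows "B2 u x = A (B u) x + B (D u) x" "D2 u x = C (B u) x + D (D u) x"
proof -
  have "Lam v M (\<lambda>y. mjoin 0 (u y)) = (\<lambda>y. mjoin (B u y) (D u y))"
    by (simp add: B_def D_def block_cn_def block_nn_def)
  then have "Lam v M (Lam v M (\<lambda>y. mjoin 0 (u y))) x =
      mjoin (A (B u) x + B (D u) x) (C (B u) x + D (D u) x)"
    by (simp add: Lam_mjoin first_order_smooth first_order_lbm assms)
  then show "B2 u x = A (B u) x + B (D u) x" "D2 u x = C (B u) x + D (D u) x"
    by (simp_all add: B2_def D2_def block_cn_def block_nn_def)
qed

lemma diff_op_B2_D2:
  assumes "diff_op F"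
  shows "diff_op (\<lambda>W. B2 (F W))" "diff_op (\<lambda>W. D2 (F W))"
  unfolding B2_def D2_def block_cn_def[abs_def] block_nn_def[abs_def] o_def
  by (intro diff_op_bounded_linear[OF bounded_linear_cons] diff_op_bounded_linear[OF bounded_linear_noncons]
      first_order_diff_op[OF first_order_Lam] diff_op_bounded_linear[OF bounded_linear_mjoin_right] assms)+

lemmas diff_op_intros = diff_op_add diff_op_diff diff_op_bounded_linear[OF bounded_linear_scaleR_right]
  first_order_diff_op[OF first_order_lbm(1)] first_order_diff_op[OF first_order_lbm(2)]
  first_order_diff_op[OF first_order_lbm(3)] first_order_diff_op[OF first_order_lbm(4)]
  first_order_diff_op[OF first_order_Sig] diff_op_B2_D2 diff_op_dd diff_op_id

context
  assumes smooth_\<Phi>: "smooth \<Phi>"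
begin

lemma diff_op_Phi: "diff_op Phi"
  unfolding Phi_def[abs_def] by (rule diff_op_smooth_comp[OF smooth_\<Phi>])

lemma diff_op_\<Gamma>1: "diff_op \<Gamma>1"
  unfolding \<Gamma>1_def[abs_def] by (intro diff_op_intros diff_op_Phi)

lemma diff_op_\<Psi>1: "diff_op \<Psi>1"
  unfolding \<Psi>1_def[abs_def] by (intro diff_op_intros diff_op_Phi diff_op_\<Gamma>1)

lemma diff_op_\<Gamma>2: "diff_op \<Gamma>2"
  unfolding \<Gamma>2_def[abs_def] by (intro diff_op_intros diff_op_\<Psi>1)

lemma diff_op_\<Psi>2: "diff_op \<Psi>2"
  unfolding \<Psi>2_def[abs_def]
  by (intro diff_op_intros diff_op_Phi diff_op_\<Gamma>1 diff_op_\<Psi>1 diff_op_\<Gamma>2)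

lemma diff_op_\<Gamma>3: "diff_op \<Gamma>3"
  unfolding \<Gamma>3_def[abs_def]
  by (intro diff_op_intros diff_op_\<Gamma>1 diff_op_\<Psi>1 diff_op_\<Psi>2)

lemma diff_op_\<Psi>3: "diff_op \<Psi>3"
  unfolding \<Psi>3_def[abs_def]
  by (intro diff_op_intros diff_op_Phi diff_op_\<Gamma>1 diff_op_\<Psi>1 diff_op_\<Gamma>2 diff_op_\<Psi>2 diff_op_\<Gamma>3)

lemma diff_op_\<Gamma>4: "diff_op \<Gamma>4"
  unfolding \<Gamma>4_def[abs_def]
  by (intro diff_op_intros diff_op_Phi diff_op_\<Gamma>1 diff_op_\<Psi>1 diff_op_\<Gamma>2 diff_op_\<Psi>2 diff_op_\<Psi>3)

end

end

lemma lift_dd_dop: "diff_op F \<Longrightarrow> diff_op G \<Longrightarrow> lift_dd G (dop F) = dop (dd F G)"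
proof (rule dop_eqI)
  fix W :: "real^'a \<Rightarrow> real^'b" and x
  assume F: "diff_op F" and G: "diff_op G" and W: "smooth W"
  have "dd (opr (dop F)) G W x = dd F G W x"
    by (rule dd_cong) (simp_all add: opr_dop F W smooth_diff_op[OF G])
  then show "opr (lift_dd G (dop F)) W x = opr (dop (dd F G)) W x"
    by (simp add: opr_lift_dd opr_dop diff_op_dd F G W)
qed

text \<open>Turns \<open>d n W\<close> of the abstract setting into the concrete n-th
  coefficient.\<close>

lemma lift_dd_id: "diff_op G \<Longrightarrow> lift_dd G (dop (\<lambda>W. W)) = dop G"
proof (rule dop_eqI)
  fix W :: "real^'a \<Rightarrow> real^'b" and x
  assume G: "diff_op G" and W: "smooth W"
  have "((\<lambda>s. W x + s *\<^sub>R G W x) has_vector_derivative G W x) (at 0)"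
    by (auto intro!: derivative_eq_intros)
  then have "dd (\<lambda>W. W) G W x = G W x"
    unfolding dd_def by (rule vector_derivative_at)
  then show "opr (lift_dd G (dop (\<lambda>W. W))) W x = opr (dop G) W x"
    by (simp add: lift_dd_dop diff_op_id G W opr_dop diff_op_dd)
qed

section \<open>Multiscale expansion of the scheme\<close>

text \<open>Translates the pairs of the abstract setting into moment-valued operators.\<close>

definition join_ops :: "('d::finite, 'c::finite, real^'c) dop \<times> ('d, 'c, real^'y::finite) dop \<Rightarrow>
    (real^'d \<Rightarrow> real^'c) \<Rightarrow> real^'d \<Rightarrow> real^('c + 'y)" where
  "join_ops z W x = mjoin (opr (fst z) W x) (opr (snd z) W x)"

lemma join_ops_add: "smooth W \<Longrightarrow> join_ops (z + z') W x = join_ops z W x + join_ops z' W x"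
  by (simp add: join_ops_def mjoin_add opr_simps)

lemma join_ops_scaleR: "smooth W \<Longrightarrow> join_ops (a *\<^sub>R z) W x = a *\<^sub>R join_ops z W x"
  by (simp add: join_ops_def mjoin_scaleR opr_simps)

lemma join_ops_uminus: "smooth W \<Longrightarrow> join_ops (- z) W x = - join_ops z W x"
  using join_ops_scaleR[of W "-1" z x] by simp

lemma join_ops_zero: "smooth W \<Longrightarrow> join_ops 0 W x = 0"
  using join_ops_scaleR[of W 0 0 x] by simp

lemma join_ops_sum: "smooth W \<Longrightarrow> join_ops (\<Sum>i\<in>I. f i) W x = (\<Sum>i\<in>I. join_ops (f i) W x)"
  by (induction I rule: infinite_finite_induct) (simp_all add: join_ops_add join_ops_zero)

lemma join_ops_diff: "smooth W \<Longrightarrow> join_ops (z - z') W x = join_ops z W x - join_ops z' W x"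
  using join_ops_add[of W z "- z'" x] by (simp add: join_ops_uminus)

lemma diff_op_join_ops: "diff_op (join_ops z)"
proof -
  have "diff_op (\<lambda>W x. mjoin (opr (fst z) W x) 0 + mjoin 0 (opr (snd z) W x))"
    by (intro diff_op_add diff_op_bounded_linear[OF bounded_linear_mjoin_left]
        diff_op_bounded_linear[OF bounded_linear_mjoin_right] diff_op_opr)
  then show ?thesis
    by (simp add: mjoin_add join_ops_def[abs_def])
qed

text \<open>The term \<open>k = 0\<close> is the only one that sees the moments of order
  \<open>n\<close> itself. It is separated because at order four the nonconserved moments have no
  prescribed form.\<close>

lemma series_exp_split:
  assumes "0 < n"
  shows "series_exp E m n W x = m n W x + (\<Sum>k=1..n. (1 / fact k) *\<^sub>R (E ^^ k) m n W x)"
  by (simp add: series_exp_def atMost_atLeast0 sum.atLeast_Suc_atMost)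

lemma exp_series_split:
  assumes "0 < n"
  shows "exp_series E m n = m n + (\<Sum>k=1..n. (1 / fact k) *\<^sub>R (E ^^ k) m n)"
  by (simp add: exp_series_def atMost_atLeast0 sum.atLeast_Suc_atMost)

text \<open>Collects the hypotheses with the three corrections indexed as one family. The conserved
  equations reach one order further than the nonconserved ones, since the fourth coefficient
  involves corrections up to the third.\<close>

locale multiscale_lbm = lbm v M \<Phi> S
  for v :: "'q::finite \<Rightarrow> real^'d::finite" and M :: "real^'q^('c::finite + 'y::finite)"
    and \<Phi> :: "real^'c \<Rightarrow> real^'y" and S :: "real^'y^'y" +
  fixes \<tau> :: real
    and Y \<Psi> :: "nat \<Rightarrow> (real^'d \<Rightarrow> real^'c) \<Rightarrow> real^'d \<Rightarrow> real^'y"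
    and T :: "nat \<Rightarrow> ((real^'d \<Rightarrow> real^'c) \<Rightarrow> real^'d \<Rightarrow> real) \<Rightarrow>
                (real^'d \<Rightarrow> real^'c) \<Rightarrow> real^'d \<Rightarrow> real"
  assumes invertible_S: "invertible S" and smooth_\<Phi>: "smooth \<Phi>" and \<tau>_pos: "\<tau> > 0"
    and diff_op_\<Psi>: "\<And>n. diff_op (\<Psi> n)"
    and Y_0: "\<And>W x. Y 0 W x = \<Phi> (W x)"
    and Y_n: "\<And>n W x. n \<in> {1..3} \<Longrightarrow> Y n W x = matrix_inv S *v (\<tau>^n *\<^sub>R \<Psi> n W x)"
    and time_derivation: "\<And>k. k \<in> {1..4} \<Longrightarrow> time_derivation (T k)"
    and cons_scheme: "\<And>n W x. n \<le> 4 \<Longrightarrow> smooth W \<Longrightarrow>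
           cons (series_exp (eps_dt \<tau> T) (mom Y) n W x) =
           cons (series_exp (eps_adv \<tau> (Lam v M)) (mom (relax S \<Phi> Y)) n W x)"
    and noncons_scheme: "\<And>n W x. n \<le> 3 \<Longrightarrow> smooth W \<Longrightarrow>
           noncons (series_exp (eps_dt \<tau> T) (mom Y) n W x) =
           noncons (series_exp (eps_adv \<tau> (Lam v M)) (mom (relax S \<Phi> Y)) n W x)"
begin

text \<open>The default \<open>\<Gamma>4\<close> at all other indices makes every member a
  differential operator, so \<open>lift_dd (\<Gamma> k)\<close> is linear for all
  \<open>k\<close>.\<close>

definition \<Gamma> :: "nat \<Rightarrow> (real^'d \<Rightarrow> real^'c) \<Rightarrow> real^'d \<Rightarrow> real^'c" where
  "\<Gamma> k = (if k = 1 then \<Gamma>1 else if k = 2 then \<Gamma>2 else if k = 3 then \<Gamma>3 else \<Gamma>4)"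

lemma diff_op_\<Gamma>: "diff_op (\<Gamma> k)"
  using smooth_\<Phi> by (simp add: \<Gamma>_def diff_op_\<Gamma>1 diff_op_\<Gamma>2 diff_op_\<Gamma>3 diff_op_\<Gamma>4)

text \<open>The abstract derivations are \<open>d k = e k = - \<tau>\<^bsup>1-k\<^esup> \<partial>\<^bsub>t\<^sub>k\<^esub>\<close>, so that all powers of \<open>\<tau>\<close> disappear.\<close>

sublocale ce: chapman_enskog "lift_field A" "lift_field B" "lift_field C" "lift_field D" "lift_field Sig"
  "\<lambda>k. lift_dd (\<Gamma> k)" "\<lambda>k. lift_dd (\<Gamma> k)" "dop (\<lambda>W. W)" "\<lambda>n. if n = 0 then dop Phi else dop (\<Psi> n)"
  by (rule chapman_enskog.intro) (rule linear_lift_field linear_lift_dd, rule first_order_lbm diff_op_\<Gamma>)+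

text \<open>The invariant carried from order to order: the k-th dynamics is already
  established.\<close>

definition time_known :: "nat \<Rightarrow> bool" where
  "time_known k \<longleftrightarrow> (\<forall>W x. smooth W \<longrightarrow> tvec (T k) (\<lambda>W. W) W x = - (\<tau> ^ (k - 1)) *\<^sub>R \<Gamma> k W x)"

lemma T_eq_dd:
  assumes k: "k \<in> {1..4}" "time_known k" and F: "diff_op F" and W: "smooth W"
  shows "T k F W x = - (\<tau> ^ (k - 1)) * dd F (\<Gamma> k) W x"
proof -
  have eq: "tvec (T k) (\<lambda>W. W) W = (\<lambda>x. - (\<tau> ^ (k - 1)) *\<^sub>R \<Gamma> k W x)"
    using k(2) W unfolding time_known_def by blast
  have s: "smooth (\<Gamma> k W)"
    by (rule smooth_diff_op[OF diff_op_\<Gamma> W])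
  have "T k F W x = dd F (tvec (T k) (\<lambda>W. W)) W x"
    using time_derivation[OF k(1)] F W unfolding time_derivation_def by blast
  also have "\<dots> = dd F (\<lambda>W x. - (\<tau> ^ (k - 1)) *\<^sub>R \<Gamma> k W x) W x"
    by (rule dd_cong) (simp_all only: eq W smooth_scaleR[OF s])
  also have "\<dots> = - (\<tau> ^ (k - 1)) * dd F (\<Gamma> k) W x"
    by (subst dd_scale_direction[where G = "\<Gamma> k", OF F W s]) simp
  finally show ?thesis .
qed

lemma dd_commutes_\<Gamma>:
  assumes k: "k \<in> {1..4}" "time_known k"
  shows "dd_commutes (\<Gamma> k)"
  unfolding dd_commutes_def
proof (intro allI impI)
  fix F :: "(real^'d \<Rightarrow> real^'c) \<Rightarrow> real^'d \<Rightarrow> real" and \<alpha>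
    and W :: "real^'d \<Rightarrow> real^'c" and x
  assume F: "diff_op F" and W: "smooth W"
  let ?c = "- (\<tau> ^ (k - 1))"
  have "?c * dd (\<lambda>W. pd \<alpha> (F W)) (\<Gamma> k) W x = T k (\<lambda>W. pd \<alpha> (F W)) W x"
    by (rule T_eq_dd[OF k diff_op_pd[OF F] W, symmetric])
  also have "\<dots> = pd \<alpha> (T k F W) x"
    using time_derivation[OF k(1)] F W unfolding time_derivation_def by blast
  also have "T k F W = (\<lambda>x. ?c *\<^sub>R dd F (\<Gamma> k) W x)"
    by (rule ext) (simp add: T_eq_dd[OF k F W])
  also have "pd \<alpha> \<dots> x = ?c *\<^sub>R pd \<alpha> (dd F (\<Gamma> k) W) x"
    by (rule pd_bounded_linear[OF bounded_linear_scaleR_right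
          smooth_diff_op[OF diff_op_dd[OF F diff_op_\<Gamma>] W]])
  finally show "dd (\<lambda>W. pd \<alpha> (F W)) (\<Gamma> k) W x = pd \<alpha> (dd F (\<Gamma> k) W) x"
    \<comment> \<open>The common factor is nonzero because \<tau> is positive.\<close>
    using \<tau>_pos by simp
qed

lemma commutes: "k \<in> {1..4} \<Longrightarrow> time_known k \<Longrightarrow> ce.commutes k"
  unfolding ce.commutes_def
  by (simp add: lift_dd_lift_field first_order_lbm dd_commutes_\<Gamma> diff_op_\<Gamma>)

text \<open>Time derivations act componentwise, and each component of a joined operator comes from
  one of the two blocks. The factor \<open>a\<close> will be a power of \<tau>.\<close>

lemma tvec_join_ops:
  fixes F :: "(real^'d \<Rightarrow> real^'c) \<Rightarrow> real^'d \<Rightarrow> real^('c + 'y)"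
  assumes k: "k \<in> {1..4}" "time_known k"
    and F: "\<And>W x. smooth W \<Longrightarrow> F W x = a *\<^sub>R join_ops z W x" and W: "smooth W"
  shows "tvec (T k) F W x =
    - (\<tau> ^ (k - 1) * a) *\<^sub>R join_ops (lift_dd (\<Gamma> k) (fst z), lift_dd (\<Gamma> k) (snd z)) W x"
proof -
  \<comment> \<open>The value type of \<open>X\<close> is arbitrary, so one computation serves both
    blocks.\<close>
  have comp: "T k (\<lambda>W y. F W y $ i) W x = - (\<tau> ^ (k - 1) * a) * dd (opr X) (\<Gamma> k) W x $ j"
    if "\<And>W x. smooth W \<Longrightarrow> join_ops z W x $ i = opr X W x $ j" for i j and X :: "('d, 'c, real^'m::finite) dop"
  proof -
    have lin: "bounded_linear (\<lambda>u::real^'m. a * u $ j)"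
      by (intro bounded_linear_const_mult bounded_linear_vec_nth)
    have eq: "F W y $ i = a * opr X W y $ j" if "smooth W" for W y
      by (simp add: F that \<open>\<And>W x. smooth W \<Longrightarrow> join_ops z W x $ i = opr X W x $ j\<close>)
    have d: "diff_op (\<lambda>W y. a * opr X W y $ j)"
      by (rule diff_op_bounded_linear[OF lin diff_op_opr])
    note s = smooth_diff_op[OF diff_op_\<Gamma> W]
    have "T k (\<lambda>W y. F W y $ i) W x = - (\<tau> ^ (k - 1)) * dd (\<lambda>W y. F W y $ i) (\<Gamma> k) W x"
      by (rule T_eq_dd[OF k _ W]) (subst diff_op_cong[OF eq], assumption, rule d)
    also have "dd (\<lambda>W y. F W y $ i) (\<Gamma> k) W x = dd (\<lambda>W y. a * opr X W y $ j) (\<Gamma> k) W x"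
      by (rule dd_cong) (simp_all add: eq W s)
    also have "\<dots> = a * dd (opr X) (\<Gamma> k) W x $ j"
      by (rule dd_bounded_linear[where K = "\<lambda>u. a * u $ j" and F = "opr X" and G = "\<Gamma> k",
            OF lin diff_op_opr W s])
    finally show ?thesis
      by simp
  qed
  show ?thesis
  proof (rule vec_eq_iff[THEN iffD2, rule_format])
    fix i :: "'c + 'y"
    show "tvec (T k) F W x $ i = (- (\<tau> ^ (k - 1) * a) *\<^sub>R
        join_ops (lift_dd (\<Gamma> k) (fst z), lift_dd (\<Gamma> k) (snd z)) W x) $ i"
    proof (cases i)
      case (Inl j)
      have "join_ops z W x $ i = opr (fst z) W x $ j" for W x
        by (simp add: join_ops_def mjoin_def Inl)
      from comp[OF this] show ?thesis
        by (simp add: tvec_def join_ops_def mjoin_def Inl opr_lift_dd diff_op_\<Gamma> W)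
    next
      case (Inr j)
      have "join_ops z W x $ i = opr (snd z) W x $ j" for W x
        by (simp add: join_ops_def mjoin_def Inr)
      from comp[OF this] show ?thesis
        by (simp add: tvec_def join_ops_def mjoin_def Inr opr_lift_dd diff_op_\<Gamma> W)
    qed
  qed
qed

text \<open>Uses linearity alone, so it also applies to a time derivation whose action is not yet
  known.\<close>

lemma tvec_zero: "k \<in> {1..4} \<Longrightarrow> smooth W \<Longrightarrow> tvec (T k) (\<lambda>_ _. 0 :: real^'m::finite) W x = 0"
proof -
  assume k: "k \<in> {1..4}" and W: "smooth W"
  have "T k (\<lambda>W' y. 0 * (\<lambda>_ _. 0) W' y + 0 * (\<lambda>_ _. 0) W' y) W x =
      0 * T k (\<lambda>_ _. 0) W x + 0 * T k (\<lambda>_ _. 0) W x"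
    using time_derivation[OF k] W diff_op_const[of "0::real"] unfolding time_derivation_def by blast
  then show ?thesis
    by (simp add: tvec_def vec_eq_iff)
qed

text \<open>Order \<open>n\<close> carries the factor \<tau>^n, and only orders below
  \<open>N\<close> are controlled; the bound records how far the known moments and time derivations
  reach.\<close>

definition represents :: "nat \<Rightarrow> (nat \<Rightarrow> (real^'d \<Rightarrow> real^'c) \<Rightarrow> real^'d \<Rightarrow> real^('c + 'y)) \<Rightarrow>
    (nat \<Rightarrow> ('d, 'c, real^'c) dop \<times> ('d, 'c, real^'y) dop) \<Rightarrow> bool" where
  "represents N m z \<longleftrightarrow> (\<forall>n<N. \<forall>W x. smooth W \<longrightarrow> m n W x = \<tau>^n *\<^sub>R join_ops (z n) W x)"

lemma representsD: "represents N m z \<Longrightarrow> n < N \<Longrightarrow> smooth W \<Longrightarrow> m n W x = \<tau>^n *\<^sub>R join_ops (z n) W x"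
  by (simp add: represents_def)

lemma eps_dt_term:
  assumes "k \<in> {1..n}" "n \<le> 4" "time_known k" "represents N m z" "n - k < N" "smooth W"
  shows "\<tau> *\<^sub>R tvec (T k) (m (n - k)) W x = - (\<tau>^n *\<^sub>R join_ops (lift_dd (\<Gamma> k) (fst (z (n - k))),
    lift_dd (\<Gamma> k) (snd (z (n - k)))) W x)"
proof -
  \<comment> \<open>The powers of \<tau> in the operator, in the k-th dynamics and in the moments
    add up to exactly \<open>n\<close>.\<close>
  have "\<tau> * (\<tau> ^ (k - 1) * \<tau> ^ (n - k)) = \<tau> ^ n"
    using assms(1) by (simp flip: power_add power_Suc)
  moreover have "k \<in> {1..4}"
    using assms(1,2) by simp
  ultimately show ?thesis
    using tvec_join_ops[OF _ assms(3) representsD[OF assms(4,5)] assms(6), of x] by simp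
qed

lemma represents_eps_dt:
  assumes "represents N m z" "N \<le> 5" "\<forall>k\<in>{1..<N}. time_known k"
  shows "represents N (eps_dt \<tau> T m) (ce.dt z)"
  unfolding represents_def
proof (intro allI impI)
  fix n W x
  assume n: "n < N" and W: "smooth (W :: real^'d \<Rightarrow> real^'c)"
  show "eps_dt \<tau> T m n W x = \<tau>^n *\<^sub>R join_ops (ce.dt z n) W x"
  proof -
    have "eps_dt \<tau> T m n W x = (\<Sum>k=1..n. - (\<tau>^n *\<^sub>R
        join_ops (lift_dd (\<Gamma> k) (fst (z (n - k))), lift_dd (\<Gamma> k) (snd (z (n - k)))) W x))"
      unfolding eps_dt_def using n assms(2,3)
      by (intro sum.cong refl eps_dt_term[OF _ _ _ assms(1) _ W]) auto
    then show ?thesis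
      unfolding ce.dt_def join_ops_uminus[OF W] join_ops_sum[OF W] by (simp only: sum_negf scaleR_sum_right scaleR_minus_right)
  qed
qed

text \<open>Advection at order \<open>n\<close> reads the moments at order \<open>n - 1\<close>,
  which gains one controlled order.\<close>

lemma represents_eps_adv:
  assumes "represents N m z"
  shows "represents (Suc N) (eps_adv \<tau> (Lam v M) m) (ce.adv z)"
  unfolding represents_def
proof (intro allI impI)
  fix n W x
  assume n: "n < Suc N" and W: "smooth (W :: real^'d \<Rightarrow> real^'c)"
  show "eps_adv \<tau> (Lam v M) m n W x = \<tau>^n *\<^sub>R join_ops (ce.adv z n) W x"
  proof (cases n)
    case 0
    then show ?thesis
      by (simp add: eps_adv_def ce.adv_def join_ops_zero W)
  next
    case (Suc k)
    have "m k W = (\<lambda>x. \<tau>^k *\<^sub>R join_ops (z k) W x)"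
      using representsD[OF assms _ W] n Suc by auto
    then have "Lam v M (m k W) x = \<tau>^k *\<^sub>R Lam v M (join_ops (z k) W) x"
      using first_order_scaleR[OF first_order_Lam smooth_diff_op[OF diff_op_join_ops W]] by simp
    also have "Lam v M (join_ops (z k) W) x = - join_ops (ce.adv z n) W x"
      unfolding join_ops_def[abs_def]
      by (subst Lam_mjoin)
        (simp_all add: ce.adv_def Suc opr_simps opr_lift_field first_order_lbm W smooth_diff_op diff_op_opr
          mjoin_scaleR[of "-1", simplified] add.commute)
    finally show ?thesis
      by (simp add: eps_adv_def Suc)
  qed
qed

lemma represents_mono: "represents N m z \<Longrightarrow> N' \<le> N \<Longrightarrow> represents N' m z"
  unfolding represents_def by auto

lemma represents_funpow_dt:
  assumes "represents N m z" "N \<le> 5" "\<forall>k\<in>{1..<N}. time_known k"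
  shows "represents N ((eps_dt \<tau> T ^^ j) m) ((ce.dt ^^ j) z)"
  by (induction j) (simp_all add: assms represents_eps_dt)

lemma represents_funpow_adv:
  assumes "represents N m z"
  shows "represents (if j = 0 then N else Suc N) ((eps_adv \<tau> (Lam v M) ^^ j) m) ((ce.adv ^^ j) z)"
proof (induction j)
  case (Suc j)
  \<comment> \<open>The extra order is given up before each further application; a gain of one is
    enough.\<close>
  then have "represents N ((eps_adv \<tau> (Lam v M) ^^ j) m) ((ce.adv ^^ j) z)"
    by (rule represents_mono) simp
  then show ?case
    using represents_eps_adv by simp
qed (simp add: assms)

lemma series_exp_adv:
  assumes "represents n m z" "0 < n" "smooth W"
  shows "series_exp (eps_adv \<tau> (Lam v M)) m n W x - m n W x =
    \<tau>^n *\<^sub>R join_ops (exp_series ce.adv z n - z n) W x"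
proof -
  have "((eps_adv \<tau> (Lam v M) ^^ k) m) n W x = \<tau>^n *\<^sub>R join_ops ((ce.adv ^^ k) z n) W x" if "k \<in> {1..n}" for k
    using representsD[OF represents_funpow_adv[OF assms(1), of k] _ assms(3)] that by simp
  then show ?thesis
    by (simp add: series_exp_split exp_series_split assms(2,3) join_ops_sum join_ops_scaleR scaleR_sum_right
        mult.commute)
qed

text \<open>At order \<open>n\<close> the derivative \<open>\<partial>\<^bsub>t\<^sub>n\<^esub>\<close> enters only through its action on the leading moments.\<close>

lemma series_exp_dt:
  assumes m: "represents n m z" and n: "n \<in> {1..4}" and known: "\<forall>k\<in>{1..<n}. time_known k"
    and W: "smooth W"
  shows "series_exp (eps_dt \<tau> T) m n W x - m n W x =
    \<tau> *\<^sub>R tvec (T n) (m 0) W x +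
    \<tau>^n *\<^sub>R join_ops (exp_series ce.dt z n - z n + (lift_dd (\<Gamma> n) (fst (z 0)), lift_dd (\<Gamma> n) (snd (z 0)))) W x"
proof -
  let ?E = "eps_dt \<tau> T"
  define \<delta> where "\<delta> z = (lift_dd (\<Gamma> n) (fst z), lift_dd (\<Gamma> n) (snd z))"
    for z :: "('d, 'c, real^'c) dop \<times> ('d, 'c, real^'y) dop"
  \<comment> \<open>At order \<open>n\<close> a single application meets \<open>T n\<close> only on
    the order-zero moments. That term is split off, and \<open>\<delta> (z' 0)\<close> restores the
    corresponding negative term contained in \<open>ce.dt\<close>.\<close>
  have top: "eps_dt \<tau> T m' n W x = \<tau> *\<^sub>R tvec (T n) (m' 0) W x + \<tau>^n *\<^sub>R join_ops (ce.dt z' n + \<delta> (z' 0)) W x"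
    if "represents n m' z'" for m' z'
  proof -
    have ivl: "{1..n} = insert n {1..<n}"
      using n by auto
    have "(\<Sum>k\<in>{1..<n}. \<tau> *\<^sub>R tvec (T k) (m' (n - k)) W x) = (\<Sum>k\<in>{1..<n}. - (\<tau>^n *\<^sub>R
        join_ops (lift_dd (\<Gamma> k) (fst (z' (n - k))), lift_dd (\<Gamma> k) (snd (z' (n - k)))) W x))"
      using n known by (intro sum.cong refl eps_dt_term[OF _ _ _ that _ W]) auto
    also have "\<dots> = \<tau>^n *\<^sub>R join_ops (- (\<Sum>k\<in>{1..<n}.
        (lift_dd (\<Gamma> k) (fst (z' (n - k))), lift_dd (\<Gamma> k) (snd (z' (n - k)))))) W x"
      by (simp only: join_ops_uminus join_ops_sum W sum_negf scaleR_sum_right scaleR_minus_right)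
    also have "- (\<Sum>k\<in>{1..<n}. (lift_dd (\<Gamma> k) (fst (z' (n - k))), lift_dd (\<Gamma> k) (snd (z' (n - k))))) =
        ce.dt z' n + \<delta> (z' 0)"
      unfolding ce.dt_def ivl \<delta>_def by (subst sum.insert) (auto simp del: uminus_Pair)
    finally show ?thesis
      unfolding eps_dt_def ivl by (subst sum.insert) auto
  qed
  have term_k: "(?E ^^ k) m n W x = (if k = 1 then \<tau> *\<^sub>R tvec (T n) (m 0) W x + \<tau>^n *\<^sub>R join_ops (\<delta> (z 0)) W x else 0)
      + \<tau>^n *\<^sub>R join_ops ((ce.dt ^^ k) z n) W x" if k: "k \<in> {1..n}" for k
  proof (cases "k = 1")
    case True
    then show ?thesis
      by (simp add: top[OF m] join_ops_add W scaleR_add_right)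
  next
    case False
    then obtain j where j: "k = Suc (Suc j)"
      using k by (intro that[of "k - 2"]) auto
    \<comment> \<open>After one application order zero is an empty sum, so from the second power on
      \<open>T n\<close> acts on the zero operator.\<close>
    have "(?E ^^ Suc j) m 0 = (\<lambda>_ _. 0)"
      by (intro ext) (simp add: eps_dt_def)
    moreover have "(ce.dt ^^ Suc j) z 0 = 0"
      by (simp add: ce.dt_def)
    moreover have "\<delta> 0 = 0"
      by (simp add: \<delta>_def linear_0[OF linear_lift_dd[OF diff_op_\<Gamma>]] zero_prod_def)
    ultimately show ?thesis
      using top[OF represents_funpow_dt[OF m _ known, of "Suc j"]] n
      by (simp add: j tvec_zero W)
  qed
  have "(\<Sum>k=1..n. (1 / fact k) *\<^sub>R (?E ^^ k) m n W x) =
      (\<Sum>k=1..n. (if k = 1 then \<tau> *\<^sub>R tvec (T n) (m 0) W x + \<tau>^n *\<^sub>R join_ops (\<delta> (z 0)) W x else 0)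
        + (1 / fact k) *\<^sub>R \<tau>^n *\<^sub>R join_ops ((ce.dt ^^ k) z n) W x)"
    by (intro sum.cong refl) (auto simp: term_k scaleR_add_right)
  also have "\<dots> = \<tau> *\<^sub>R tvec (T n) (m 0) W x + \<tau>^n *\<^sub>R join_ops (\<delta> (z 0)) W x +
      \<tau>^n *\<^sub>R join_ops (\<Sum>k=1..n. (1 / fact k) *\<^sub>R (ce.dt ^^ k) z n) W x"
    using n by (simp add: sum.distrib join_ops_sum join_ops_scaleR W scaleR_sum_right mult.commute)
  finally show ?thesis
    using n by (simp add: series_exp_split exp_series_split \<delta>_def join_ops_add W scaleR_add_right)
qed

lemma S_matrix_inv: "S *v (matrix_inv S *v y) = y"
  using someI_ex[OF invertible_S[unfolded invertible_def]]
  by (simp add: matrix_vector_mul_assoc matrix_inv_def)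

text \<open>Since S^-1 is \<Sigma> + I/2, a correction S^-1 \<Psi> becomes \<Sigma> \<Psi> +
  \<Psi>/2 before relaxation. Relaxation subtracts \<Psi>, which leaves \<Sigma> \<Psi> -
  \<Psi>/2.\<close>

lemma represents_moments:
  "represents 4 (mom Y) (ce.moments (1/2))"
  "represents 4 (mom (relax S \<Phi> Y)) (ce.moments (-1/2))"
proof -
  have "mom Y n W x = \<tau>^n *\<^sub>R join_ops (ce.moments (1/2) n) W x \<and>
      mom (relax S \<Phi> Y) n W x = \<tau>^n *\<^sub>R join_ops (ce.moments (-1/2) n) W x"
    if n: "n < 4" and W: "smooth W" for n W x
  proof (cases "n = 0")
    case True
    then show ?thesis
      by (simp add: mom_def relax_def ce.moments_def join_ops_def Y_0 opr_dop W diff_op_id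
          diff_op_Phi smooth_\<Phi> Phi_def)
  next
    case False
    let ?y = "matrix_inv S *v \<Psi> n W x"
    have Y: "Y n W x = \<tau>^n *\<^sub>R ?y"
      using False n by (simp add: Y_n matrix_vector_mult_scaleR)
    have Sig: "Sig (\<Psi> n W) x = ?y - (1/2) *\<^sub>R \<Psi> n W x"
      by (simp only: Sig_def matrix_vector_mult_diff_rdistrib scaleR_matrix_vector_assoc[symmetric]
          matrix_vector_mul_lid)
    have relax: "relax S \<Phi> Y n W x = \<tau>^n *\<^sub>R (?y - \<Psi> n W x)"
      using False
      by (simp add: relax_def Y matrix_vector_mult_scaleR S_matrix_inv
          linear_neg[OF matrix_vector_mul_linear] scaleR_diff_right)
    have moments: "join_ops (ce.moments c n) W x = mjoin 0 (Sig (\<Psi> n W) x + c *\<^sub>R \<Psi> n W x)" for c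
      using False
      by (simp add: ce.moments_def join_ops_def opr_simps opr_dop W diff_op_\<Psi> opr_lift_field first_order_lbm)
    have "Sig (\<Psi> n W) x + (1/2) *\<^sub>R \<Psi> n W x = ?y" "Sig (\<Psi> n W) x + (-1/2) *\<^sub>R \<Psi> n W x = ?y - \<Psi> n W x"
      unfolding Sig by (simp_all add: vec_eq_iff)
    then show ?thesis
      unfolding moments using False by (simp only: mom_def relax Y mjoin_scaleR if_False scaleR_zero_right)
  qed
  then show "represents 4 (mom Y) (ce.moments (1/2))"
    "represents 4 (mom (relax S \<Phi> Y)) (ce.moments (-1/2))"
    by (simp_all add: represents_def)
qed

section \<open>Solving the scheme order by order\<close>

lemma cons_tvec_mom_0: "cons (tvec (T n) (mom Y 0) W x) = tvec (T n) (\<lambda>W. W) W x"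
  by (simp add: cons_def tvec_def mom_def mjoin_def)

lemma cons_mom: "0 < n \<Longrightarrow> cons (mom y n W x) = 0"
  by (simp add: mom_def)

lemma fst_moments_0: "fst (ce.moments c 0) = dop (\<lambda>W. W)"
  and fst_moments: "0 < n \<Longrightarrow> fst (ce.moments c n) = 0"
  by (simp_all add: ce.moments_def)

lemma cons_join_ops: "cons (join_ops z W x) = opr (fst z) W x"
  and noncons_join_ops: "noncons (join_ops z W x) = opr (snd z) W x"
  by (simp_all add: join_ops_def)

lemmas cons_simps = linear_simps[OF bounded_linear_cons]
lemmas noncons_simps = linear_simps[OF bounded_linear_noncons]

text \<open>The order \<open>n\<close> equation is affine in the n-th time derivative of W, with
  coefficient \<tau>. By \<open>eq\<close> the explicit formula solves it, and \<tau> > 0 gives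
  uniqueness. Conserved components of higher moments vanish, so order four is included.\<close>

lemma time_knownI:
  assumes n: "n \<in> {1..4}" and known: "\<forall>k\<in>{1..<n}. time_known k"
    and eq: "fst (exp_series ce.dt (ce.moments (1/2)) n) = fst (exp_series ce.adv (ce.moments (-1/2)) n)"
  shows "time_known n"
  unfolding time_known_def
proof (intro allI impI)
  fix W :: "real^'d \<Rightarrow> real^'c" and x
  assume W: "smooth W"
  have n0: "0 < n" and n4: "n \<le> 4"
    using n by auto
  note rep = represents_mono[OF represents_moments(1) n4] represents_mono[OF represents_moments(2) n4]
  \<comment> \<open>The added \<open>\<Gamma> n W x\<close> undoes the term \<open>- d n W\<close>
    inside the abstract exponential, where the true time derivative now stands.\<close>
  have "\<tau> *\<^sub>R tvec (T n) (\<lambda>W. W) W x + \<tau>^n *\<^sub>R (opr (fst (exp_series ce.dt (ce.moments (1/2)) n)) W x + \<Gamma> n W x) =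
      cons (series_exp (eps_dt \<tau> T) (mom Y) n W x)"
    using arg_cong[OF series_exp_dt[OF rep(1) n known W, of x], of cons] n0
    by (simp add: cons_simps cons_mom cons_join_ops cons_tvec_mom_0 fst_moments_0 fst_moments
        lift_dd_id diff_op_\<Gamma> opr_simps opr_dop W)
  also have "\<dots> = cons (series_exp (eps_adv \<tau> (Lam v M)) (mom (relax S \<Phi> Y)) n W x)"
    by (rule cons_scheme[OF n4 W])
  also have "\<dots> = \<tau>^n *\<^sub>R opr (fst (exp_series ce.adv (ce.moments (-1/2)) n)) W x"
    using arg_cong[OF series_exp_adv[OF rep(2) n0 W, of x], of cons] n0
    by (simp add: cons_simps cons_mom cons_join_ops fst_moments opr_simps W)
  finally have "\<tau> *\<^sub>R tvec (T n) (\<lambda>W. W) W x + \<tau>^n *\<^sub>R \<Gamma> n W x = 0"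
    by (simp add: eq scaleR_add_right)
  moreover have "\<tau>^n = \<tau> * \<tau>^(n - 1)"
    using n0 by (simp flip: power_Suc)
  ultimately have "\<tau> *\<^sub>R (tvec (T n) (\<lambda>W. W) W x + \<tau>^(n - 1) *\<^sub>R \<Gamma> n W x) = 0"
    by (simp add: scaleR_add_right)
  then show "tvec (T n) (\<lambda>W. W) W x = - (\<tau> ^ (n - 1)) *\<^sub>R \<Gamma> n W x"
    using \<tau>_pos by (simp add: eq_neg_iff_add_eq_0)
qed

text \<open>Once the n-th dynamics is known, both exponentials are represented at order
  \<open>n\<close> and the factor \<tau>^n cancels. Here the scheme is transferred to the abstract
  setting in order to be solved for the correction.\<close>

lemma noncons_eqI:
  assumes n: "n \<in> {1..3}" and known: "\<forall>k\<in>{1..n}. time_known k"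
  shows "snd (exp_series ce.dt (ce.moments (1/2)) n) = snd (exp_series ce.adv (ce.moments (-1/2)) n)"
proof (rule dop_eqI)
  fix W :: "real^'d \<Rightarrow> real^'c" and x
  assume W: "smooth W"
  have n0: "0 < n" and n3: "n < 4" "n \<le> 3" "n \<le> 4" "n \<in> {1..4}"
    using n by auto
  have known': "\<forall>k\<in>{1..<n}. time_known k" "time_known n"
    using known n by auto
  let ?d = "(lift_dd (\<Gamma> n) (fst (ce.moments (1/2) 0)), lift_dd (\<Gamma> n) (snd (ce.moments (1/2) 0)))"
  note rep = represents_mono[OF represents_moments(1) n3(3)] represents_mono[OF represents_moments(2) n3(3)]
  have "mom Y 0 W x = 1 *\<^sub>R join_ops (ce.moments (1/2) 0) W x" if "smooth W" for W x
    using representsD[OF represents_moments(1) _ that, of 0] by simp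
  from tvec_join_ops[OF n3(4) known'(2) this W]
  have "\<tau> *\<^sub>R tvec (T n) (mom Y 0) W x = - (\<tau>^n *\<^sub>R join_ops ?d W x)"
    using n0 by (simp flip: power_Suc mult.assoc)
  then have "series_exp (eps_dt \<tau> T) (mom Y) n W x =
      \<tau>^n *\<^sub>R join_ops (exp_series ce.dt (ce.moments (1/2)) n) W x"
    using series_exp_dt[OF rep(1) n3(4) known'(1) W, of x]
    by (simp add: representsD[OF represents_moments(1) n3(1) W] join_ops_add join_ops_diff W
        scaleR_add_right scaleR_diff_right)
  moreover have "series_exp (eps_adv \<tau> (Lam v M)) (mom (relax S \<Phi> Y)) n W x =
      \<tau>^n *\<^sub>R join_ops (exp_series ce.adv (ce.moments (-1/2)) n) W x"
    using series_exp_adv[OF rep(2) n0 W, of x]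
    by (simp add: representsD[OF represents_moments(2) n3(1) W] join_ops_diff W scaleR_diff_right)
  ultimately show "opr (snd (exp_series ce.dt (ce.moments (1/2)) n)) W x =
      opr (snd (exp_series ce.adv (ce.moments (-1/2)) n)) W x"
    using noncons_scheme[OF n3(2) W, of x] \<tau>_pos
    by (simp add: noncons_simps noncons_join_ops)
qed

section \<open>Identification with the explicit formulas\<close>

lemma B2_D2_fun:
  assumes "smooth u"
  shows "B2 u = (\<lambda>x. A (B u) x + B (D u) x)" "D2 u = (\<lambda>x. C (B u) x + D (D u) x)"
  by (rule ext; rule B2_D2_eq[OF assms])+

lemmas diff_ops = diff_op_id diff_op_Phi[OF smooth_\<Phi>] diff_op_\<Gamma>1[OF smooth_\<Phi>] diff_op_\<Psi>1[OF smooth_\<Phi>]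
  diff_op_\<Gamma>2[OF smooth_\<Phi>] diff_op_\<Psi>2[OF smooth_\<Phi>] diff_op_\<Gamma>3[OF smooth_\<Phi>] diff_op_\<Psi>3[OF smooth_\<Phi>]
  diff_op_\<Gamma>4[OF smooth_\<Phi>] diff_op_dd

lemmas eval_simps = lift_dd_id lift_dd_dop opr_lift_field opr_simps opr_add_fun opr_dop first_order_lbm
  diff_ops smooth_diff_op[OF diff_op_\<Psi>1[OF smooth_\<Phi>]] smooth_diff_op[OF diff_op_\<Psi>2[OF smooth_\<Phi>]]
  first_order_smooth[OF first_order_Sig] B2_D2_fun

text \<open>Both sides are the explicit coefficient, one of them as the derivative of the identity
  along it.\<close>

lemma ce_Gamma_eq1: "ce.Gamma_eq1"
  unfolding ce.Gamma_eq1_def by (rule dop_eqI) (simp add: eval_simps \<Gamma>_def \<Gamma>1_def)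

lemma dop_Psi1:
  assumes "ce.Psi_eq1"
  shows "dop (\<Psi> 1) = dop \<Psi>1"
proof -
  have "dop (\<Psi> 1) = lift_dd (\<Gamma> 1) (dop Phi) - (lift_field C (dop (\<lambda>W. W)) + lift_field D (dop Phi))"
    using assms by (simp add: ce.Psi_eq1_def)
  also have "\<dots> = dop \<Psi>1"
    by (rule dop_eqI) (simp add: eval_simps \<Gamma>_def \<Psi>1_def)
  finally show ?thesis .
qed

lemma ce_Gamma_eq2: "dop (\<Psi> 1) = dop \<Psi>1 \<Longrightarrow> ce.Gamma_eq2"
  unfolding ce.Gamma_eq2_def by (rule dop_eqI) (simp add: eval_simps \<Gamma>_def \<Gamma>2_def)

lemma dop_Psi2:
  assumes "dop (\<Psi> 1) = dop \<Psi>1" "ce.Psi_eq2"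
  shows "dop (\<Psi> 2) = dop \<Psi>2"
  using assms(2) unfolding ce.Psi_eq2_def
  by simp (rule dop_eqI, simp add: assms(1)[unfolded One_nat_def] eval_simps \<Gamma>_def \<Psi>2_def)

lemma ce_Gamma_eq3: "dop (\<Psi> 1) = dop \<Psi>1 \<Longrightarrow> dop (\<Psi> 2) = dop \<Psi>2 \<Longrightarrow> ce.Gamma_eq3"
  unfolding ce.Gamma_eq3_def by (rule dop_eqI) (simp add: eval_simps \<Gamma>_def \<Gamma>3_def)

lemma dop_Psi3:
  assumes "dop (\<Psi> 1) = dop \<Psi>1" "dop (\<Psi> 2) = dop \<Psi>2" "ce.Psi_eq3"
  shows "dop (\<Psi> 3) = dop \<Psi>3"
  using assms(3) unfolding ce.Psi_eq3_def
  by simp (rule dop_eqI, simp add: assms(1)[unfolded One_nat_def] assms(2) eval_simps \<Gamma>_def \<Psi>3_def)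

lemma ce_Gamma_eq4: "dop (\<Psi> 1) = dop \<Psi>1 \<Longrightarrow> dop (\<Psi> 2) = dop \<Psi>2 \<Longrightarrow> dop (\<Psi> 3) = dop \<Psi>3 \<Longrightarrow> ce.Gamma_eq4"
  unfolding ce.Gamma_eq4_def by (rule dop_eqI) (simp add: eval_simps \<Gamma>_def \<Gamma>4_def)

lemma \<Psi>_eq_if_dop_eq: "dop (\<Psi> n) = dop F \<Longrightarrow> diff_op F \<Longrightarrow> smooth W \<Longrightarrow> \<Psi> n W x = F W x"
  using opr_dop[OF diff_op_\<Psi>[of n], of W] opr_dop[of F W] by simp

text \<open>Each order yields the dynamics, then commutation, then the correction. The given
  correction must be identified with the explicit one before the next order, because the explicit
  coefficients refer to the latter and the abstract equations to the former.\<close>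

lemma multiscale_dynamics:
  "time_known 1" "time_known 2" "time_known 3" "time_known 4"
  "dop (\<Psi> 1) = dop \<Psi>1" "dop (\<Psi> 2) = dop \<Psi>2" "dop (\<Psi> 3) = dop \<Psi>3"
proof -
  show t1: "time_known 1"
    by (rule time_knownI[OF _ _ ce.cons_eq_1[OF ce_Gamma_eq1]]) simp_all
  have c1: "ce.commutes 1"
    by (rule commutes[OF _ t1]) simp
  have "\<forall>k\<in>{1..1}. time_known k"
    using t1 by simp
  then have Psi_eq1: "ce.Psi_eq1"
    by (intro ce.noncons_eq_1 noncons_eqI) simp
  show P1: "dop (\<Psi> 1) = dop \<Psi>1"
    by (rule dop_Psi1[OF Psi_eq1])
  note Gamma_eq2 = ce_Gamma_eq2[OF P1]
  have ivl: "{1..<2} = {1::nat}" "{1..<3} = {1, 2::nat}" "{1..<4} = {1, 2, 3::nat}"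
    "{1..2} = {1, 2::nat}" "{1..3} = {1, 2, 3::nat}"
    by auto
  have "\<forall>k\<in>{1..<2}. time_known k"
    unfolding ivl using t1 by simp
  then show t2: "time_known 2"
    by (intro time_knownI ce.cons_eq_2 c1 ce_Gamma_eq1 Psi_eq1 Gamma_eq2) simp
  have c2: "ce.commutes 2"
    by (rule commutes[OF _ t2]) simp
  have "\<forall>k\<in>{1..2}. time_known k"
    unfolding ivl using t1 t2 by simp
  then have Psi_eq2: "ce.Psi_eq2"
    by (intro ce.noncons_eq_2[OF c1 ce_Gamma_eq1 Psi_eq1 Gamma_eq2] noncons_eqI) simp
  show P2: "dop (\<Psi> 2) = dop \<Psi>2"
    by (rule dop_Psi2[OF P1 Psi_eq2])
  note Gamma_eq3 = ce_Gamma_eq3[OF P1 P2]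
  have "\<forall>k\<in>{1..<3}. time_known k"
    unfolding ivl using t1 t2 by simp
  then show t3: "time_known 3"
    by (intro time_knownI ce.cons_eq_3 c1 c2 ce_Gamma_eq1 Psi_eq1 Gamma_eq2 Psi_eq2 Gamma_eq3) simp
  have c3: "ce.commutes 3"
    by (rule commutes[OF _ t3]) simp
  have "\<forall>k\<in>{1..3}. time_known k"
    unfolding ivl using t1 t2 t3 by simp
  then have Psi_eq3: "ce.Psi_eq3"
    by (intro ce.noncons_eq_3[OF c1 c2 ce_Gamma_eq1 Psi_eq1 Gamma_eq2 Psi_eq2 Gamma_eq3] noncons_eqI) simp
  show P3: "dop (\<Psi> 3) = dop \<Psi>3"
    by (rule dop_Psi3[OF P1 P2 Psi_eq3])
  have "\<forall>k\<in>{1..<4}. time_known k"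
    unfolding ivl using t1 t2 t3 by simp
  then show "time_known 4"
    by (intro time_knownI ce.cons_eq_4 c1 c2 c3 ce_Gamma_eq1 Psi_eq1 Gamma_eq2 Psi_eq2 Gamma_eq3 Psi_eq3 ce_Gamma_eq4[OF P1 P2 P3]) simp
qed

end

theorem proposition2:
  fixes v :: "'q::finite \<Rightarrow> real^'d::finite"
    and M :: "real^'q^('c::finite + 'y::finite)"
    and \<Phi> :: "real^'c \<Rightarrow> real^'y"
    and S :: "real^'y^'y"
    and \<tau> :: real
    and Y :: "nat \<Rightarrow> (real^'d \<Rightarrow> real^'c) \<Rightarrow> real^'d \<Rightarrow> real^'y"
    and \<Psi>\<^sub>1 \<Psi>\<^sub>2 \<Psi>\<^sub>3 :: "(real^'d \<Rightarrow> real^'c) \<Rightarrow> real^'d \<Rightarrow> real^'y"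
    and T :: "nat \<Rightarrow> ((real^'d \<Rightarrow> real^'c) \<Rightarrow> real^'d \<Rightarrow> real) \<Rightarrow>
                (real^'d \<Rightarrow> real^'c) \<Rightarrow> real^'d \<Rightarrow> real"
  assumes "invertible M" and "invertible S" and "smooth \<Phi>" and "\<tau> > 0"
    and "diff_op \<Psi>\<^sub>1" and "diff_op \<Psi>\<^sub>2" and "diff_op \<Psi>\<^sub>3"
    and "\<forall>W x. Y 0 W x = \<Phi> (W x)"
    and "\<forall>W x. Y 1 W x = matrix_inv S *v (\<tau> *\<^sub>R \<Psi>\<^sub>1 W x)"
    and "\<forall>W x. Y 2 W x = matrix_inv S *v (\<tau>\<^sup>2 *\<^sub>R \<Psi>\<^sub>2 W x)"
    and "\<forall>W x. Y 3 W x = matrix_inv S *v (\<tau>^3 *\<^sub>R \<Psi>\<^sub>3 W x)"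
    and "\<forall>k\<in>{1..4}. time_derivation (T k)"
    and "\<forall>n\<le>4. \<forall>W x. smooth W \<longrightarrow>
           cons (series_exp (eps_dt \<tau> T) (mom Y) n W x) =
           cons (series_exp (eps_adv \<tau> (Lam v M)) (mom (relax S \<Phi> Y)) n W x)"
    and "\<forall>n\<le>3. \<forall>W x. smooth W \<longrightarrow>
           noncons (series_exp (eps_dt \<tau> T) (mom Y) n W x) =
           noncons (series_exp (eps_adv \<tau> (Lam v M)) (mom (relax S \<Phi> Y)) n W x)"
  shows "(\<forall>W x. smooth W \<longrightarrow>
           tvec (T 1) (\<lambda>W. W) W x + lbm.\<Gamma>1 v M \<Phi> W x = 0 \<and>
           tvec (T 2) (\<lambda>W. W) W x + \<tau> *\<^sub>R lbm.\<Gamma>2 v M \<Phi> S W x = 0 \<and>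
           tvec (T 3) (\<lambda>W. W) W x + \<tau>\<^sup>2 *\<^sub>R lbm.\<Gamma>3 v M \<Phi> S W x = 0 \<and>
           tvec (T 4) (\<lambda>W. W) W x + \<tau>^3 *\<^sub>R lbm.\<Gamma>4 v M \<Phi> S W x = 0 \<and>
           \<Psi>\<^sub>1 W x = lbm.\<Psi>1 v M \<Phi> W x \<and>
           \<Psi>\<^sub>2 W x = lbm.\<Psi>2 v M \<Phi> S W x \<and>
           \<Psi>\<^sub>3 W x = lbm.\<Psi>3 v M \<Phi> S W x) \<and>
         diff_op (lbm.\<Gamma>1 v M \<Phi>) \<and> diff_op (lbm.\<Gamma>2 v M \<Phi> S) \<and>
         diff_op (lbm.\<Gamma>3 v M \<Phi> S) \<and> diff_op (lbm.\<Gamma>4 v M \<Phi> S)"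
proof -
  \<comment> \<open>All remaining indices take the third correction, so that every member of the
    family is a differential operator.\<close>
  define \<Psi> where "\<Psi> n = (if n = (1::nat) then \<Psi>\<^sub>1 else if n = 2 then \<Psi>\<^sub>2 else \<Psi>\<^sub>3)" for n
  interpret multiscale_lbm v M \<Phi> S \<tau> Y \<Psi> T
  proof (rule multiscale_lbm.intro)
    fix n W x
    assume "n \<in> {1..3::nat}"
    then have "n = 1 \<or> n = 2 \<or> n = 3"
      by auto
    then show "Y n W x = matrix_inv S *v (\<tau>^n *\<^sub>R \<Psi> n W x)"
      using assms(9-11) by (auto simp: \<Psi>_def)
  qed (use assms in \<open>simp_all add: \<Psi>_def\<close>)
  have "tvec (T 1) (\<lambda>W. W) W x + \<Gamma>1 W x = 0 \<and>
      tvec (T 2) (\<lambda>W. W) W x + \<tau> *\<^sub>R \<Gamma>2 W x = 0 \<and>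
      tvec (T 3) (\<lambda>W. W) W x + \<tau>\<^sup>2 *\<^sub>R \<Gamma>3 W x = 0 \<and>
      tvec (T 4) (\<lambda>W. W) W x + \<tau>^3 *\<^sub>R \<Gamma>4 W x = 0" if "smooth W" for W x
    using multiscale_dynamics(1-4) that by (simp add: time_known_def \<Gamma>_def)
  moreover have "\<Psi>\<^sub>1 W x = \<Psi>1 W x" "\<Psi>\<^sub>2 W x = \<Psi>2 W x" "\<Psi>\<^sub>3 W x = \<Psi>3 W x" if "smooth W" for W x
    using \<Psi>_eq_if_dop_eq[OF multiscale_dynamics(5) diff_ops(4) that]
      \<Psi>_eq_if_dop_eq[OF multiscale_dynamics(6) diff_ops(6) that]
      \<Psi>_eq_if_dop_eq[OF multiscale_dynamics(7) diff_ops(8) that]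
    by (simp_all add: \<Psi>_def)
  ultimately show ?thesis
    using diff_ops(3,5,7,9) by blast
qed

end
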